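(* Let $\gamma > 0$ and $1 < \beta \leq 2$, and let $a_n := \left\lfloor e^{\gamma (\log n)^{\beta}} \right\rfloor$ for $n \geq 1$. Then for (Lebesgue) almost all $\alpha \in \mathbb{R}$ the star-discrepancy $D_N^* = D_N^*(\{a_1\alpha\}, \ldots, \{a_N\alpha\})$ of $(\{a_n \alpha\})_{n \geq 1}$ satisfies $$N D_N^* = \Omega\left(N^{\frac{7}{26} - \varepsilon}\right) \quad \text{for all } \varepsilon > 0.$$
   Context: $\{x\}$ denotes the fractional part and $\lfloor x \rfloor$ the integer part (floor) of a real number $x$. For points $x_1, \ldots, x_N \in [0,1)$ the star-discrepancy is $D_N^*(x_1,\ldots,x_N) := \sup_{0 < b \leq 1} \left| \frac{A_N(b)}{N} - b \right|$, where $A_N(b) := \#\{1 \leq n \leq N : x_n \in [0,b)\}$. $f(N) = \Omega(g(N))$ means that there is a constant $c > 0$ with $f(N) \geq c\, g(N)$ for infinitely many $N$. *)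

theory Defs
  imports "HOL-Analysis.Analysis"
begin

definition counting :: "(nat \<Rightarrow> real) \<Rightarrow> nat \<Rightarrow> real \<Rightarrow> nat" where
  "counting x N b = card {n \<in> {1..N}. x n \<in> {0..<b}}"

text \<open>The points are \<open>x 1, \<dots>, x N\<close>; the value \<open>x 0\<close> is not used.\<close>

definition star_discrepancy :: "(nat \<Rightarrow> real) \<Rightarrow> nat \<Rightarrow> real" where
  "star_discrepancy x N = (SUP b\<in>{0<..1}. \<bar>real (counting x N b) / real N - b\<bar>)"

text \<open>This is the \<open>\<Omega>\<close> of Hardy and Littlewood: the lower bound is required for infinitely many
  \<open>N\<close> only. The library constant \<open>bigomega\<close> requires it for all sufficiently large \<open>N\<close>.\<close>

definition Omega_io :: "(nat \<Rightarrow> real) \<Rightarrow> (nat \<Rightarrow> real) set" where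
  "Omega_io g = {f. \<exists>c>0. infinite {N. f N \<ge> c * g N}}"

definition a_seq :: "real \<Rightarrow> real \<Rightarrow> nat \<Rightarrow> int" where
  "a_seq \<gamma> \<beta> n = \<lfloor>exp (\<gamma> * (ln (real n)) powr \<beta>)\<rfloor>"

end

(*
  Consider the block of indices (N, N + L] with N = q^7 and L = q^4, and the exponential sum
  S(alpha) = sum of e(a_n alpha) over the block. By Koksma's inequality |S| is at most
  2 pi ((N + L) D*_(N+L) + N D*_N), so it suffices that |S| is at least a constant times
  L^(1/2) = q^2 for infinitely many q: this even gives the exponent 2/7 > 7/26.

  On a fixed interval the mean of |S|^2 is asymptotic to L, because the gaps of a_n grow faster than
  any power of n, and the mean of |S|^4 is O(L^2), because a_k + a_l = a_m + a_n has only O(L^2)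
  solutions in the block, even up to an error L^4. Hence |S| >= L^(1/2) / 2 on a fixed proportion
  of every interval once q is large, and a set which contains, for infinitely many q, a fixed
  proportion of every interval has full measure by a density argument.

  To count solutions with m < k < l < n, fix d = k - m and s = l - m. The second difference of
  F(x) = exp(gamma (log x)^beta) shows that d + s - (n - m) is close to d s F''/F', which varies
  by O(L^3 / N^2) up to logarithms, that is by less than 1, over the block; so n - m is
  determined. Then m is determined too, since the quotient of F(m + (n - m)) - F(m + s) and
  F(m + d) - F(m) is strictly monotone in m, because F''/F' is strictly decreasing.
*)

theory Submission
  imports Defs "HOL-Real_Asymp.Real_Asymp"
begin

subsection \<open>Exponential sums and the star-discrepancy\<close>

lemma counting_le: "counting x N b \<le> N"
proof -
  have "counting x N b \<le> card {1..N}"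
    unfolding counting_def by (rule card_mono) auto
  then show ?thesis by simp
qed

lemma counting_diff_le:
  assumes "0 < N" "b \<in> {0<..1}"
  shows "\<bar>real (counting x N b) - real N * b\<bar> \<le> real N * star_discrepancy x N"
proof -
  \<comment> \<open>The supremum is taken in the reals, so it bounds its terms only once the family
    is known to be bounded.\<close>
  have "\<bar>real (counting x N c) / real N - c\<bar> \<le> 1" if "c \<in> {0<..1}" for c
  proof -
    have "0 \<le> real (counting x N c) / real N" "real (counting x N c) / real N \<le> 1"
      using counting_le[of x N c] by (simp_all add: divide_le_eq)
    then show ?thesis using that unfolding abs_le_iff greaterThanAtMost_iff by linarith
  qed
  then have "bdd_above ((\<lambda>b. \<bar>real (counting x N b) / real N - b\<bar>) ` {0<..1})"
    by (intro bdd_aboveI2)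
  then have "\<bar>real (counting x N b) / real N - b\<bar> \<le> star_discrepancy x N"
    unfolding star_discrepancy_def using assms by (intro cSUP_upper)
  moreover have "\<bar>real (counting x N b) - real N * b\<bar> = real N * \<bar>real (counting x N b) / real N - b\<bar>"
    using assms by (simp add: abs_mult_pos' field_simps abs_if)
  ultimately show ?thesis by (simp add: mult_left_mono)
qed

text \<open>Koksma's inequality for \<open>e\<close>: the number \<open>1 - e (x n)\<close> is the
  integral of \<open>g = e'\<close> over \<open>b > x n\<close>, so summation gives the integral of
  \<open>counting x N b * g b\<close>. The integral of \<open>b * g b\<close> is 1, and the
  difference \<open>counting x N b - N * b\<close> is controlled by the discrepancy while
  \<open>g\<close> has modulus \<open>2 * pi\<close>.\<close>

lemma norm_sum_cis_le_star_discrepancy: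
  assumes x: "\<And>n. x n \<in> {0..<1}"
  shows "cmod (\<Sum>n = 1..N. cis (2 * pi * x n)) \<le> 2 * pi * (real N * star_discrepancy x N)"
proof (cases "N = 0")
  case False
  define e where "e b = cis (2 * pi * b)" for b
  define g where "g b = 2 * pi * \<i> * e b" for b
  have e: "(e has_vector_derivative g b) (at b within S)" for b S
    unfolding e_def[abs_def] g_def cis_conv_exp
    by (auto intro!: derivative_eq_intros has_vector_derivative_real_field simp: algebra_simps)
  have e1: "e 0 = 1" "e 1 = 1" by (simp_all add: e_def)
  have "((\<lambda>b. if x n < b then g b else 0) has_integral (1 - e (x n))) {0..1}" for n
  proof -
    have "(g has_integral (e 1 - e (x n))) {x n..1}"
      using x[of n] by (intro fundamental_theorem_of_calculus e) auto
    then have "((\<lambda>b. if b \<in> {x n..1} then g b else 0) has_integral (1 - e (x n))) {0..1}"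
      using x[of n] by (subst has_integral_restrict) (auto simp: e1)
    \<comment> \<open>The two integrands differ only at \<open>b = x n\<close>; the strict
      inequality matches the half-open interval in \<open>counting\<close>.\<close>
    then show ?thesis
      by (rule has_integral_spike[where S = "{x n}", rotated 2]) auto
  qed
  then have "((\<lambda>b. \<Sum>n = 1..N. if x n < b then g b else 0) has_integral (\<Sum>n = 1..N. 1 - e (x n))) {0..1}"
    by (intro has_integral_sum) auto
  also have "(\<lambda>b. \<Sum>n = 1..N. if x n < b then g b else 0) = (\<lambda>b. of_nat (counting x N b) * g b)"
  proof
    fix b
    have "(\<Sum>n = 1..N. if x n < b then g b else 0) = (\<Sum>n\<in>{n \<in> {1..N}. x n < b}. g b)"
      by (rule sum.inter_filter[symmetric]) simp
    also have "{n \<in> {1..N}. x n < b} = {n \<in> {1..N}. x n \<in> {0..<b}}" using x by auto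
    finally show "(\<Sum>n = 1..N. if x n < b then g b else 0) = of_nat (counting x N b) * g b"
      by (simp add: counting_def)
  qed
  finally have 1: "((\<lambda>b. of_nat (counting x N b) * g b) has_integral (\<Sum>n = 1..N. 1 - e (x n))) {0..1}" .
  \<comment> \<open>Integration by parts: the primitive is
    \<open>b * e b - e b / (2 * pi * \<i>)\<close>, and by periodicity the second term contributes
    nothing.\<close>
  have "((\<lambda>b. of_real b * g b) has_integral
      (of_real 1 * e 1 - e 1 / (2 * pi * \<i>) - (of_real 0 * e 0 - e 0 / (2 * pi * \<i>)))) {0..1}"
    by (intro fundamental_theorem_of_calculus)
       (auto intro!: derivative_eq_intros e has_vector_derivative_of_real simp: g_def)
  from has_integral_mult_right[OF this, of "of_nat N"]
  have 2: "((\<lambda>b. of_nat N * (of_real b * g b)) has_integral of_nat N) {0..1}"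
    by (simp add: e1)
  have "((\<lambda>b. of_real (real (counting x N b) - real N * b) * g b) has_integral
      (\<Sum>n = 1..N. 1 - e (x n)) - of_nat N) {0..1}"
    using has_integral_diff[OF 1 2] by (simp add: algebra_simps)
  moreover have "cmod (of_real (real (counting x N b) - real N * b) * g b) \<le> 2 * pi * (real N * star_discrepancy x N)"
    if "b \<in> cbox 0 1" for b
  proof -
    have D0: "0 \<le> real N * star_discrepancy x N"
      using counting_diff_le[of N 1 x] False by (auto intro: order_trans[OF abs_ge_zero])
    have "\<bar>real (counting x N b) - real N * b\<bar> \<le> real N * star_discrepancy x N"
    \<comment> \<open>The supremum leaves out \<open>b = 0\<close>, where the counting function
      vanishes.\<close>
    proof (cases "b = 0")
      case True
      then show ?thesis using D0 by (simp add: counting_def)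
    next
      case b: False
      show ?thesis by (rule counting_diff_le) (use b that False in auto)
    qed
    then have "2 * pi * \<bar>real (counting x N b) - real N * b\<bar> \<le> 2 * pi * (real N * star_discrepancy x N)"
      by (intro mult_left_mono) auto
    then show ?thesis by (simp add: norm_mult g_def e_def mult.commute del: of_real_diff)
  qed
  moreover have "0 \<le> 2 * pi * (real N * star_discrepancy x N)"
    using counting_diff_le[of N 1 x] False by (auto intro: order_trans[OF abs_ge_zero])
  ultimately have "cmod ((\<Sum>n = 1..N. 1 - e (x n)) - of_nat N) \<le>
      2 * pi * (real N * star_discrepancy x N) * measure lborel (cbox (0::real) 1)"
    by (intro has_integral_bound) auto
  then show ?thesis
    by (simp add: sum_subtractf norm_minus_cancel e_def)
qed simp

subsection \<open>Sets of positive density at every scale\<close>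

text \<open>Enclose \<open>A\<close> in an open \<open>U\<close> of almost the same measure and
  extract from \<open>U\<close>, by Vitali, disjoint balls that cover almost all of
  \<open>A\<close>. As \<open>A\<close> fills at most the proportion \<open>c\<close> of each ball,
  its measure is at most \<open>c\<close> times that of \<open>U\<close>; let \<open>U\<close>
  shrink.\<close>

lemma negligible_if_sparse_in_balls:
  fixes A :: "'a::euclidean_space set"
  assumes A: "A \<in> lmeasurable" and "c < 1"
    and sparse: "\<And>x d. 0 < d \<Longrightarrow> measure lebesgue (A \<inter> ball x d) \<le> c * measure lebesgue (ball x d)"
  shows "negligible A"
proof -
  \<comment> \<open>Sparsity in the unit ball already forces \<open>c\<close> to be
    nonnegative.\<close>
  have "0 \<le> c * measure lebesgue (ball (0::'a) 1)"
    by (rule order_trans[OF measure_nonneg sparse]) simp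
  moreover have "0 < measure lebesgue (ball (0::'a) 1)"
    using content_ball_pos[OF zero_less_one, of "0::'a"] by simp
  ultimately have c: "0 \<le> c"
    using mult_neg_pos[of c "measure lebesgue (ball (0::'a) 1)"] by linarith
  have le: "measure lebesgue A \<le> c * (measure lebesgue A + e)" if "0 < e" for e
  proof -
    obtain U where U: "open U" "A \<subseteq> U" "U - A \<in> lmeasurable" "emeasure lebesgue (U - A) < ennreal e"
      using sets_lebesgue_outer_open[of A e] A \<open>0 < e\<close> by blast
    have "U = A \<union> (U - A)" using U by auto
    then have U_meas: "U \<in> lmeasurable" using A U by (metis fmeasurable.Un)
    have "measure lebesgue U = measure lebesgue A + measure lebesgue (U - A)"
      using measure_Un_AE[of A "U - A" lebesgue] A U \<open>U = A \<union> (U - A)\<close> by auto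
    moreover have "measure lebesgue (U - A) < e"
      using U(3,4) that by (simp add: emeasure_eq_measure2 ennreal_less_iff)
    ultimately have mU: "measure lebesgue U \<le> measure lebesgue A + e" by simp
    define K where "K = {(x, d). 0 < d \<and> ball x d \<subseteq> U}"
    have cover: "\<exists>i. i \<in> K \<and> x \<in> ball (fst i) (snd i) \<and> snd i < d" if x: "x \<in> A" "0 < d" for x d
    proof -
      obtain k where k: "0 < k" "ball x k \<subseteq> U" 
        using U(1,2) x(1) unfolding open_contains_ball by blast
      then show ?thesis
        \<comment> \<open>\<open>k\<close> keeps the ball inside \<open>U\<close>, and
          \<open>d / 2\<close> makes the radius strictly smaller than \<open>d\<close>.\<close>
        using x by (intro exI[of _ "(x, min k (d / 2))"]) (auto simp: K_def)
    qed
    obtain C where C: "countable C" "C \<subseteq> K"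
        "pairwise (\<lambda>i j. disjnt (ball (fst i) (snd i)) (ball (fst j) (snd j))) C"
        "negligible (A - (\<Union>i\<in>C. ball (fst i) (snd i)))"
      by (rule Vitali_covering_theorem_balls[of A K fst snd]) (use cover in auto)
    define b where "b i = ball (fst i) (snd i)" for i :: "'a \<times> real"
    have disj: "disjoint_family_on b C"
      using C(3) by (auto simp: disjoint_family_on_def pairwise_def disjnt_def b_def)
    have meas: "(\<Union>i\<in>C. A \<inter> b i) \<in> sets lebesgue"
      using C(1) A by (intro sets.countable_UN') (auto simp: b_def)
    have null: "A - (\<Union>i\<in>C. b i) \<in> null_sets lebesgue"
      using C(4) by (simp add: b_def negligible_iff_null_sets)
    have "emeasure lebesgue A \<le> emeasure lebesgue ((\<Union>i\<in>C. A \<inter> b i) \<union> (A - (\<Union>i\<in>C. b i)))"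
      using meas null_setsD2[OF null] by (intro emeasure_mono sets.Un) auto
    also have "\<dots> = emeasure lebesgue (\<Union>i\<in>C. A \<inter> b i)"
      by (rule emeasure_Un_null_set[OF meas null])
    also have "\<dots> = (\<integral>\<^sup>+i. emeasure lebesgue (A \<inter> b i) \<partial>count_space C)"
    proof (rule emeasure_UN_countable)
      show "disjoint_family_on (\<lambda>i. A \<inter> b i) C" using disj unfolding disjoint_family_on_def by blast
      show "A \<inter> b i \<in> sets lebesgue" for i using A by (auto simp: b_def)
    qed (rule C(1))
    also have "\<dots> \<le> (\<integral>\<^sup>+i. ennreal c * emeasure lebesgue (b i) \<partial>count_space C)"
    proof (rule nn_integral_mono)
      fix i assume "i \<in> space (count_space C)"
      then have "0 < snd i" using C(2) by (auto simp: K_def)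
      then have "measure lebesgue (A \<inter> b i) \<le> c * measure lebesgue (b i)"
        using sparse by (simp add: b_def)
      moreover have "A \<inter> b i \<in> lmeasurable" "b i \<in> lmeasurable"
        using A by (auto simp: b_def fmeasurable.Int)
      ultimately show "emeasure lebesgue (A \<inter> b i) \<le> ennreal c * emeasure lebesgue (b i)"
        using c by (simp add: emeasure_eq_measure2 flip: ennreal_mult)
    qed
    also have "\<dots> = ennreal c * (\<integral>\<^sup>+i. emeasure lebesgue (b i) \<partial>count_space C)"
      by (rule nn_integral_cmult) simp
    also have "(\<integral>\<^sup>+i. emeasure lebesgue (b i) \<partial>count_space C) = emeasure lebesgue (\<Union>i\<in>C. b i)"
      by (rule emeasure_UN_countable[symmetric, OF _ C(1) disj]) (simp add: b_def)
    also have "\<dots> \<le> emeasure lebesgue U"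
    proof (rule emeasure_mono)
      show "(\<Union>i\<in>C. b i) \<subseteq> U" using C(2) unfolding b_def K_def by fastforce
    qed (use U_meas in blast)
    finally have "emeasure lebesgue A \<le> ennreal c * emeasure lebesgue U"
      by (simp add: mult_left_mono)
    then have "measure lebesgue A \<le> c * measure lebesgue U"
      using A U_meas c by (simp add: emeasure_eq_measure2 flip: ennreal_mult)
    also have "\<dots> \<le> c * (measure lebesgue A + e)" using mU c by (rule mult_left_mono)
    finally show ?thesis .
  qed
  have "measure lebesgue A \<le> c * measure lebesgue A"
  proof (rule field_le_epsilon)
    fix e :: real assume "0 < e"
    have "measure lebesgue A \<le> c * measure lebesgue A + c * e" using le[OF \<open>0 < e\<close>] by (simp add: algebra_simps)
    also have "c * e \<le> e" using \<open>c < 1\<close> \<open>0 < e\<close> by (simp add: mult_le_cancel_right)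
    finally show "measure lebesgue A \<le> c * measure lebesgue A + e" by simp
  qed
  then have "(1 - c) * measure lebesgue A \<le> 0" by (simp add: algebra_simps)
  then have "measure lebesgue A = 0"
    using \<open>c < 1\<close> by (simp add: mult_le_0_iff measure_le_0_iff)
  then show ?thesis using A by (simp add: negligible_iff_measure)
qed

text \<open>A point outside the limsup misses all \<open>T q\<close> with \<open>q \<ge> n\<close>
  for some \<open>n\<close>. The set of such points fills at most the proportion
  \<open>1 - c\<close> of every interval, hence is null; cutting it with \<open>ball 0 m\<close>
  makes its measure finite, and there are countably many pairs \<open>m\<close>,
  \<open>n\<close>.\<close>

lemma AE_frequently_in_if_uniformly_dense:
  fixes T :: "nat \<Rightarrow> real set"
  assumes T: "\<And>q. T q \<in> sets lebesgue" and "0 < c"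
    and dense: "\<And>x y. x < y \<Longrightarrow> eventually (\<lambda>q. c * (y - x) \<le> measure lebesgue (T q \<inter> {x..y})) sequentially"
  shows "AE \<alpha> in lebesgue. \<exists>\<^sub>F q in sequentially. \<alpha> \<in> T q"
proof -
  have null: "negligible (ball 0 (real m) - (\<Union>q\<in>{n..}. T q))" for m n
  proof -
    define G where "G = (\<Union>q\<in>{n..}. T q)"
    have G: "G \<in> sets lebesgue" using T by (auto simp: G_def)
    have meas: "ball 0 (real m) - G \<in> lmeasurable"
      using G by (intro fmeasurable_Diff) auto
    show "negligible (ball 0 (real m) - (\<Union>q\<in>{n..}. T q))"
      unfolding G_def[symmetric]
    proof (rule negligible_if_sparse_in_balls[OF meas])
      show "1 - c < 1" using \<open>0 < c\<close> by simp
      fix x d :: real assume d: "0 < d"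
      have "eventually (\<lambda>q. c * ((x + d) - (x - d)) \<le> measure lebesgue (T q \<inter> {x - d..x + d}) \<and> n \<le> q) sequentially"
        using d by (intro eventually_conj dense eventually_ge_at_top) auto
      then obtain q where q: "c * (2 * d) \<le> measure lebesgue (T q \<inter> {x - d..x + d})" "n \<le> q"
        by (auto simp: eventually_sequentially)
      have I: "G \<inter> {x - d..x + d} \<in> lmeasurable" 
        using G by (intro fmeasurable_Int_fmeasurable[of "{x - d..x + d}", simplified Int_commute]) auto
      have "measure lebesgue (T q \<inter> {x - d..x + d}) \<le> measure lebesgue (G \<inter> {x - d..x + d})"
        using q T I by (intro measure_mono_fmeasurable) (auto simp: G_def)
      then have "c * (2 * d) \<le> measure lebesgue (G \<inter> {x - d..x + d})" using q by simp
      moreover have "measure lebesgue ({x - d..x + d} - G \<inter> {x - d..x + d}) =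
          measure lebesgue {x - d..x + d} - measure lebesgue (G \<inter> {x - d..x + d})"
        using I by (intro measurable_measure_Diff) auto
      moreover have "measure lebesgue ((ball 0 (real m) - G) \<inter> ball x d) \<le>
          measure lebesgue ({x - d..x + d} - G \<inter> {x - d..x + d})"
        using meas I by (intro measure_mono_fmeasurable fmeasurable_Diff) 
          (auto simp: dist_real_def intro!: sets.Int)
      moreover have "measure lebesgue (ball x d) = 2 * d"
        using d by (simp add: ball_eq_greaterThanLessThan)
      ultimately show "measure lebesgue ((ball 0 (real m) - G) \<inter> ball x d) \<le> (1 - c) * measure lebesgue (ball x d)"
        using d by (simp add: algebra_simps)
    qed
  qed
  have "AE \<alpha> in lebesgue. \<forall>n m. \<alpha> \<notin> ball 0 (real m) - (\<Union>q\<in>{n..}. T q)"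
    unfolding AE_all_countable
    using null by (intro allI AE_not_in) (simp add: negligible_iff_null_sets)
  then show ?thesis
  proof eventually_elim
    case (elim \<alpha>)
    obtain m where "\<bar>\<alpha>\<bar> < real m" using reals_Archimedean2 by blast
    then show ?case using elim by (force simp: frequently_sequentially)
  qed
qed

subsection \<open>Local moments of exponential sums\<close>

text \<open>The index type is arbitrary so that the square of such a sum is again one, indexed by
  pairs.\<close>

definition expsum :: "('a \<Rightarrow> real) \<Rightarrow> 'a set \<Rightarrow> real \<Rightarrow> complex" where
  "expsum f B \<alpha> = (\<Sum>i\<in>B. cis (2 * pi * f i * \<alpha>))"

lemma continuous_on_expsum: "continuous_on A (expsum f B)"
  unfolding expsum_def[abs_def] by (intro continuous_intros)

lemma norm_expsum_squared:
  "(cmod (expsum f B \<alpha>))\<^sup>2 = (\<Sum>(i, j)\<in>B \<times> B. cos (2 * pi * (f i - f j) * \<alpha>))"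
proof -
  have "complex_of_real ((cmod (expsum f B \<alpha>))\<^sup>2) = expsum f B \<alpha> * cnj (expsum f B \<alpha>)"
    by (simp only: complex_norm_square)
  also have "\<dots> = (\<Sum>(i, j)\<in>B \<times> B. cis (2 * pi * (f i - f j) * \<alpha>))"
    by (simp add: expsum_def sum_product sum.cartesian_product cis_cnj cis_mult algebra_simps)
  finally have "(cmod (expsum f B \<alpha>))\<^sup>2 = Re (\<Sum>(i, j)\<in>B \<times> B. cis (2 * pi * (f i - f j) * \<alpha>))"
    by (metis Re_complex_of_real)
  then show ?thesis by (simp add: case_prod_unfold)
qed

lemma expsum_squared:
  "(expsum f B \<alpha>)\<^sup>2 = expsum (\<lambda>(k, l). f k + f l) (B \<times> B) \<alpha>"
  by (simp add: expsum_def power2_eq_square sum_product sum.cartesian_product cis_mult case_prod_unfold algebra_simps)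

lemma abs_integral_cos_le:
  assumes "x \<le> y" "w \<noteq> 0"
  shows "\<bar>integral {x..y} (\<lambda>\<alpha>. cos (2 * pi * w * \<alpha>))\<bar> \<le> 1 / \<bar>w\<bar>"
proof -
  have "((\<lambda>\<alpha>. cos (2 * pi * w * \<alpha>)) has_integral
      sin (2 * pi * w * y) / (2 * pi * w) - sin (2 * pi * w * x) / (2 * pi * w)) {x..y}"
    using assms
    by (intro fundamental_theorem_of_calculus)
       (auto intro!: derivative_eq_intros simp flip: has_real_derivative_iff_has_vector_derivative)
  then have "integral {x..y} (\<lambda>\<alpha>. cos (2 * pi * w * \<alpha>)) =
     (sin (2 * pi * w * y) - sin (2 * pi * w * x)) / (2 * pi * w)"
    by (simp add: integral_unique diff_divide_distrib)
  also have "\<bar>\<dots>\<bar> = \<bar>sin (2 * pi * w * y) - sin (2 * pi * w * x)\<bar> / (2 * pi * \<bar>w\<bar>)"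
    by (simp add: abs_mult)
  also have "\<dots> \<le> 2 / (2 * 1 * \<bar>w\<bar>)"
  proof (rule frac_le)
    show "\<bar>sin (2 * pi * w * y) - sin (2 * pi * w * x)\<bar> \<le> 2"
      using abs_sin_le_one[of "2 * pi * w * y"] abs_sin_le_one[of "2 * pi * w * x"] by linarith
    show "2 * 1 * \<bar>w\<bar> \<le> 2 * pi * \<bar>w\<bar>"
      using pi_gt3 by (intro mult_mono) auto
  qed (use assms in auto)
  finally show ?thesis by simp
qed

lemma abs_integral_cos_le_length:
  assumes "x \<le> y"
  shows "\<bar>integral {x..y} (\<lambda>\<alpha>. cos (2 * pi * w * \<alpha>))\<bar> \<le> y - x"
proof -
  have "norm (integral (cbox x y) (\<lambda>\<alpha>. cos (2 * pi * w * \<alpha>))) \<le> 1 * measure lborel (cbox x y)"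
    by (rule integrable_bound) (auto intro!: integrable_continuous_real continuous_intros)
  with assms show ?thesis by simp
qed

lemma integral_norm_expsum_squared:
  assumes "finite B"
  shows "integral {x..y} (\<lambda>\<alpha>. (cmod (expsum f B \<alpha>))\<^sup>2) =
    (\<Sum>(i, j)\<in>B \<times> B. integral {x..y} (\<lambda>\<alpha>. cos (2 * pi * (f i - f j) * \<alpha>)))"
  using assms unfolding norm_expsum_squared case_prod_unfold
  by (intro integral_sum) (auto intro!: integrable_continuous_real continuous_intros)

text \<open>The diagonal gives the main term, and every other pair oscillates with frequency at
  least \<open>g\<close>, so it costs at most \<open>1 / g\<close>.\<close>

lemma second_moment_ge:
  assumes "finite B" "x \<le> y" "0 < g"
    and gap: "\<And>i j. i \<in> B \<Longrightarrow> j \<in> B \<Longrightarrow> i \<noteq> j \<Longrightarrow> g \<le> \<bar>f i - f j\<bar>"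
  shows "real (card B) * (y - x) - (real (card B))\<^sup>2 / g \<le> integral {x..y} (\<lambda>\<alpha>. (cmod (expsum f B \<alpha>))\<^sup>2)"
proof -
  \<comment> \<open>The loss \<open>1 / g\<close> is charged to the diagonal as well, to keep the
    total simple.\<close>
  have "(\<Sum>(i, j)\<in>B \<times> B. (if i = j then y - x else 0) - 1 / g)
     \<le> (\<Sum>(i, j)\<in>B \<times> B. integral {x..y} (\<lambda>\<alpha>. cos (2 * pi * (f i - f j) * \<alpha>)))"
  proof (rule sum_mono, clarify)
    fix i j assume ij: "i \<in> B" "j \<in> B"
    show "(if i = j then y - x else 0) - 1 / g \<le> integral {x..y} (\<lambda>\<alpha>. cos (2 * pi * (f i - f j) * \<alpha>))"
    proof (cases "i = j")
      case False
      then have "\<bar>integral {x..y} (\<lambda>\<alpha>. cos (2 * pi * (f i - f j) * \<alpha>))\<bar> \<le> 1 / \<bar>f i - f j\<bar>"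
        using gap[OF ij] assms by (intro abs_integral_cos_le) auto
      also have "\<dots> \<le> 1 / g"
        using gap[OF ij False] assms by (intro divide_left_mono) auto
      finally show ?thesis using False by auto
    qed (use assms in auto)
  qed
  moreover have "(\<Sum>(i, j)\<in>B \<times> B. (if i = j then y - x else 0) - 1 / g)
     = real (card B) * (y - x) - (real (card B))\<^sup>2 / g"
    using assms by (simp add: sum.cartesian_product[symmetric] sum_subtractf power2_eq_square right_diff_distrib)
  ultimately show ?thesis using assms by (simp add: integral_norm_expsum_squared)
qed

text \<open>Pairs with frequency at most \<open>W\<close> are bounded trivially by the length of the
  interval, all others by \<open>1 / W\<close>.\<close>

lemma second_moment_le:
  assumes "finite B" "x \<le> y" "0 < W"
  shows "integral {x..y} (\<lambda>\<alpha>. (cmod (expsum f B \<alpha>))\<^sup>2) \<le>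
     real (card {(i, j) \<in> B \<times> B. \<bar>f i - f j\<bar> \<le> W}) * (y - x) + (real (card B))\<^sup>2 / W"
proof -
  have "(\<Sum>(i, j)\<in>B \<times> B. integral {x..y} (\<lambda>\<alpha>. cos (2 * pi * (f i - f j) * \<alpha>)))
    \<le> (\<Sum>(i, j)\<in>B \<times> B. (if \<bar>f i - f j\<bar> \<le> W then y - x else 0) + 1 / W)"
  proof (rule sum_mono, clarify)
    fix i j
    show "integral {x..y} (\<lambda>\<alpha>. cos (2 * pi * (f i - f j) * \<alpha>)) \<le> (if \<bar>f i - f j\<bar> \<le> W then y - x else 0) + 1 / W"
    proof (cases "\<bar>f i - f j\<bar> \<le> W")
      case True
      have "integral {x..y} (\<lambda>\<alpha>. cos (2 * pi * (f i - f j) * \<alpha>)) \<le> y - x"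
        using abs_integral_cos_le_length[OF assms(2), of "f i - f j"] by linarith
      also have "\<dots> \<le> (if \<bar>f i - f j\<bar> \<le> W then y - x else 0) + 1 / W"
        using True assms by simp
      finally show ?thesis .
    next
      case False
      then have "\<bar>integral {x..y} (\<lambda>\<alpha>. cos (2 * pi * (f i - f j) * \<alpha>))\<bar> \<le> 1 / \<bar>f i - f j\<bar>"
        using assms by (intro abs_integral_cos_le) auto
      also have "\<dots> \<le> 1 / W"
        using False assms by (intro divide_left_mono) auto
      finally show ?thesis using False by auto
    qed
  qed
  also have "\<dots> = (\<Sum>p\<in>B \<times> B. if p \<in> {(i, j). \<bar>f i - f j\<bar> \<le> W} then y - x else 0) + (real (card B))\<^sup>2 / W"
    using assms by (simp add: case_prod_unfold sum.distrib power2_eq_square card_cartesian_product)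
  also have "(\<Sum>p\<in>B \<times> B. if p \<in> {(i, j). \<bar>f i - f j\<bar> \<le> W} then y - x else 0) =
      real (card {(i, j) \<in> B \<times> B. \<bar>f i - f j\<bar> \<le> W}) * (y - x)"
  proof -
    have "{(i, j) \<in> B \<times> B. \<bar>f i - f j\<bar> \<le> W} = (B \<times> B) \<inter> {(i, j). \<bar>f i - f j\<bar> \<le> W}" by auto
    then show ?thesis
      using assms by (simp only: sum.inter_restrict[symmetric] finite_cartesian_product) simp
  qed
  finally show ?thesis using assms by (simp add: integral_norm_expsum_squared)
qed

text \<open>Additive energy with tolerance \<open>W\<close>; \<open>W = 0\<close> is the usual
  additive energy. The tolerance allows a real-valued function to stand in for its integer
  part.\<close>

definition quasi_energy :: "('a \<Rightarrow> real) \<Rightarrow> 'a set \<Rightarrow> real \<Rightarrow> nat" where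
  "quasi_energy f B W =
     card {(k, l, m, n) \<in> B \<times> B \<times> B \<times> B. \<bar>f k + f l - f m - f n\<bar> \<le> W}"

text \<open>This is \<open>second_moment_le\<close> for the sum over pairs with frequencies
  \<open>f k + f l\<close>, whose close pairs are counted by the quasi-energy.\<close>

lemma fourth_moment_le:
  assumes "finite B" "x \<le> y" "0 < W"
  shows "integral {x..y} (\<lambda>\<alpha>. (cmod (expsum f B \<alpha>)) ^ 4) \<le>
     real (quasi_energy f B W) * (y - x) + (real (card B)) ^ 4 / W"
proof -
  define T where "T = {(i, j) \<in> (B \<times> B) \<times> (B \<times> B).
      \<bar>(case i of (k, l) \<Rightarrow> f k + f l) - (case j of (k, l) \<Rightarrow> f k + f l)\<bar> \<le> W}"
  have "card T = quasi_energy f B W"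
    unfolding quasi_energy_def
    by (rule bij_betw_same_card[of "\<lambda>((k, l), (m, n)). (k, l, m, n)"])
       (auto simp: bij_betw_def inj_on_def T_def image_iff algebra_simps)
  moreover have "(cmod (expsum f B \<alpha>)) ^ 4 = (cmod (expsum (\<lambda>(k, l). f k + f l) (B \<times> B) \<alpha>))\<^sup>2" for \<alpha>
    by (simp flip: expsum_squared add: norm_power power_mult[symmetric])
  ultimately show ?thesis
    using second_moment_le[of "B \<times> B" x y W "\<lambda>(k, l). f k + f l"] assms
    by (simp add: T_def card_cartesian_product power_mult_distrib flip: power_mult power2_eq_square)
qed

text \<open>A Paley-Zygmund argument: if \<open>v\<close> were large only on a small set, its
  integral would be too small, because the second moment of \<open>v\<close> prevents
  concentration.\<close>

lemma large_values_measure: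
  assumes B: "finite B" "B \<noteq> {}" and xy: "x < y" and C: "0 < C"
    and two: "3 / 4 * real (card B) * (y - x) \<le> integral {x..y} (\<lambda>\<alpha>. (cmod (expsum f B \<alpha>))\<^sup>2)"
    and four: "integral {x..y} (\<lambda>\<alpha>. (cmod (expsum f B \<alpha>)) ^ 4) \<le> C * (real (card B))\<^sup>2 * (y - x)"
  shows "(y - x) / (16 * C) \<le> measure lebesgue ({\<alpha>. real (card B) / 4 \<le> (cmod (expsum f B \<alpha>))\<^sup>2} \<inter> {x..y})"
proof -
  define N where "N = real (card B)"
  have N: "0 < N" using B by (simp add: N_def card_gt_0_iff)
  define v where "v \<alpha> = (cmod (expsum f B \<alpha>))\<^sup>2" for \<alpha>
  have v_cont: "continuous_on A v" for A
    unfolding v_def[abs_def] by (intro continuous_intros continuous_on_expsum)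
  define T where "T = {\<alpha>. N / 4 \<le> v \<alpha>}"
  have "closed T"
    unfolding T_def by (intro closed_Collect_le continuous_intros v_cont)
  then have T: "T \<inter> {x..y} \<in> lmeasurable"
    by (intro lmeasurable_compact closed_Int_compact) auto
  have v_int: "v integrable_on {x..y}" "(\<lambda>\<alpha>. (v \<alpha>)\<^sup>2) integrable_on {x..y}"
    by (intro integrable_continuous_real continuous_intros v_cont)+
  have T_int: "(indicator T :: real \<Rightarrow> real) integrable_on {x..y}"
    using T integrable_on_indicator by blast
  have "integral {x..y} v \<le> integral {x..y} (\<lambda>\<alpha>. N / 4 + 4 * C * N * indicator T \<alpha> + 1 / (4 * C * N) * (v \<alpha>)\<^sup>2)"
  proof (rule integral_le)
    fix \<alpha>
    show "v \<alpha> \<le> N / 4 + 4 * C * N * indicator T \<alpha> + 1 / (4 * C * N) * (v \<alpha>)\<^sup>2"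
    proof (cases "\<alpha> \<in> T")
      case True
      \<comment> \<open>With \<open>K = 4 * C * N\<close> the quadratic term integrates to at most
        \<open>N * (y - x) / 4\<close>. Together with the part off \<open>T\<close> this uses half
        of the length, which leaves a quarter for \<open>T\<close>.\<close>
      have "v \<alpha> \<le> K + 1 / K * (v \<alpha>)\<^sup>2" if "0 < K" for K
      proof -
        have "0 \<le> (v \<alpha> - K)\<^sup>2 + v \<alpha> * K" using that by (simp add: v_def)
        then have "v \<alpha> * K \<le> K * K + (v \<alpha>)\<^sup>2" by (simp add: power2_eq_square algebra_simps)
        then show ?thesis using that by (simp add: field_simps)
      qed
      from this[of "4 * C * N"] show ?thesis using True C N by simp
    next
      case False
      have "0 \<le> 1 / (4 * C * N) * (v \<alpha>)\<^sup>2" using C N by simp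
      with False show ?thesis by (simp add: T_def)
    qed
  qed (intro integrable_add integrable_on_mult_right v_int T_int integrable_const_ivl)+
  also have "\<dots> = N / 4 * (y - x) + 4 * C * N * measure lebesgue (T \<inter> {x..y})
      + 1 / (4 * C * N) * integral {x..y} (\<lambda>\<alpha>. (v \<alpha>)\<^sup>2)"
    using xy T
    by (subst integral_add integral_mult_right integral_indicator;
        (intro integrable_add integrable_on_mult_right v_int T_int integrable_const_ivl)?)+
       (simp_all add: Int_commute)
  also have "1 / (4 * C * N) * integral {x..y} (\<lambda>\<alpha>. (v \<alpha>)\<^sup>2) \<le> 1 / (4 * C * N) * (C * N\<^sup>2 * (y - x))"
    using four C N by (intro mult_left_mono) (simp_all add: v_def N_def flip: power_mult)
  also have "\<dots> = N * (y - x) / 4" using C N by (simp add: power2_eq_square)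
  finally have "integral {x..y} v \<le>
      N / 4 * (y - x) + 4 * C * N * measure lebesgue (T \<inter> {x..y}) + N * (y - x) / 4"
    by simp
  moreover have "3 / 4 * N * (y - x) \<le> integral {x..y} v"
    using two unfolding v_def N_def .
  ultimately have "N * (y - x) \<le> N * (16 * C * measure lebesgue (T \<inter> {x..y}))"
    by argo
  then have "y - x \<le> 16 * C * measure lebesgue (T \<inter> {x..y})" using N by simp
  then show ?thesis using C by (simp add: field_simps T_def v_def N_def)
qed

subsection \<open>Additive quadruples in short blocks\<close>

text \<open>\<open>F1\<close> is the derivative of \<open>F\<close>, \<open>\<rho>\<close> is
  \<open>F''/F'\<close> and \<open>\<rho>1\<close> its derivative, so \<open>\<rho>\<close>
  decreases at a rate between \<open>c\<close> and \<open>M\<close>. The window has length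
  \<open>2 * L\<close> because the second difference at \<open>x\<close> reaches
  \<open>x + s + d\<close>, possibly beyond the block. \<open>curvature_small\<close> serves to
  determine the outer gap, the second part of \<open>W_small\<close> to determine the base
  point.\<close>

locale convex_block =
  fixes F F1 \<rho> \<rho>1 :: "real \<Rightarrow> real" and N L W c M r :: real
  assumes F: "\<And>x. x \<in> {N..N + 2 * L} \<Longrightarrow> (F has_real_derivative F1 x) (at x)"
    and F1: "\<And>x. x \<in> {N..N + 2 * L} \<Longrightarrow> (F1 has_real_derivative F1 x * \<rho> x) (at x)"
    and \<rho>: "\<And>x. x \<in> {N..N + 2 * L} \<Longrightarrow> (\<rho> has_real_derivative \<rho>1 x) (at x)"
    and F1_pos: "\<And>x. x \<in> {N..N + 2 * L} \<Longrightarrow> 0 < F1 x"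
    and \<rho>_bounds: "\<And>x. x \<in> {N..N + 2 * L} \<Longrightarrow> 0 \<le> \<rho> x \<and> \<rho> x \<le> r"
    and \<rho>1_bounds: "\<And>x. x \<in> {N..N + 2 * L} \<Longrightarrow> - M \<le> \<rho>1 x \<and> \<rho>1 x \<le> - c"
    and L_pos: "0 < L"
    and c_pos: "0 < c"
    and W_nonneg: "0 \<le> W"
    and Lr: "L * r \<le> 1 / 2"
    and curvature_small: "L ^ 3 * (6 * M + 8 * r\<^sup>2) + 2 * W / F1 N < 1"
    and W_small: "W / F1 N \<le> 1 / 4" "4 * W / F1 N < c"
begin

lemma F1_N_pos: "0 < F1 N"
  using L_pos by (intro F1_pos) auto

lemma r_nonneg: "0 \<le> r"
  using \<rho>_bounds[of N] L_pos by auto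

lemma M_pos: "0 < M"
  using \<rho>1_bounds[of N] c_pos L_pos by auto

lemma F_shift:
  "x + h \<in> {N..N + 2 * L} \<Longrightarrow> ((\<lambda>x. F (x + h)) has_real_derivative F1 (x + h)) (at x)"
  using F DERIV_shift by blast

lemma F1_mono: 
  assumes "N \<le> x" "x \<le> y" "y \<le> N + 2 * L"
  shows "F1 x \<le> F1 y"
proof (rule DERIV_nonneg_imp_nondecreasing[OF assms(2)])
  fix z assume "x \<le> z" "z \<le> y"
  then have z: "z \<in> {N..N + 2 * L}" using assms by auto
  show "\<exists>w. (F1 has_real_derivative w) (at z) \<and> 0 \<le> w"
    using F1[OF z] \<rho>_bounds[OF z] F1_pos[OF z] by (intro exI[of _ "F1 z * \<rho> z"]) auto
qed

lemma F1_ge: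
  assumes "x \<in> {N..N + 2 * L}"
  shows "F1 N \<le> F1 x"
  using F1_mono[of N x] assms by auto

text \<open>Gronwall: the logarithmic derivative of \<open>F1\<close> is at most \<open>r\<close>,
  so \<open>F1\<close> grows at most by the factor \<open>exp (2 * L * r)\<close>, which is
  linearised by \<open>2 * L * r \<le> 1\<close>.\<close>

lemma F1_ratio: 
  assumes "x \<in> {N..N + 2 * L}" "y \<in> {N..N + 2 * L}"
  shows "F1 y \<le> F1 x * (1 + 4 * L * r)"
proof (cases "x \<le> y")
  case True
  have "F1 y * exp (- r * y) \<le> F1 x * exp (- r * x)"
  proof (rule DERIV_nonpos_imp_nonincreasing[OF True])
    fix z assume "x \<le> z" "z \<le> y"
    then have z: "z \<in> {N..N + 2 * L}" using assms by auto
    have "((\<lambda>z. F1 z * exp (- r * z)) has_real_derivative F1 z * exp (- r * z) * (\<rho> z - r)) (at z)"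
      by (auto intro!: derivative_eq_intros F1[OF z] simp: algebra_simps)
    moreover have "F1 z * exp (- r * z) * (\<rho> z - r) \<le> 0"
      using F1_pos[OF z] \<rho>_bounds[OF z] by (simp add: mult_nonneg_nonpos)
    ultimately show "\<exists>w. ((\<lambda>z. F1 z * exp (- r * z)) has_real_derivative w) (at z) \<and> w \<le> 0"
      by blast
  qed
  then have "F1 y \<le> F1 x * exp (r * (y - x))"
    by (simp add: exp_minus exp_diff right_diff_distrib field_simps)
  also have "exp (r * (y - x)) \<le> exp (2 * L * r)"
    using assms r_nonneg by (simp add: mult.commute[of r] mult_right_mono)
  also have "\<dots> \<le> 1 + 2 * L * r + (2 * L * r)\<^sup>2"
    by (rule exp_bound) (use Lr r_nonneg L_pos in auto)
  also have "(2 * L * r)\<^sup>2 \<le> 2 * L * r"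
    using mult_right_mono[of "2 * L * r" 1 "2 * L * r"] Lr r_nonneg L_pos by (simp add: power2_eq_square)
  finally show ?thesis
    using F1_pos[OF assms(1)] by (simp add: mult_le_cancel_left_pos algebra_simps)
next
  case False
  then have "F1 y \<le> F1 x" using F1_mono assms by auto
  also have "\<dots> \<le> F1 x * (1 + 4 * L * r)"
    using F1_pos[OF assms(1)] r_nonneg L_pos by (simp add: algebra_simps)
  finally show ?thesis .
qed

lemma \<rho>_diff:
  assumes "N \<le> x" "x \<le> y" "y \<le> N + 2 * L"
  shows "c * (y - x) \<le> \<rho> x - \<rho> y" "\<rho> x - \<rho> y \<le> M * (y - x)"
proof -
  have "c * (y - x) \<le> \<rho> x - \<rho> y \<and> \<rho> x - \<rho> y \<le> M * (y - x)"
  proof (cases "x = y")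
    case False
    then obtain z where z: "x < z" "z < y" "\<rho> y - \<rho> x = (y - x) * \<rho>1 z"
      using MVT2[of x y \<rho> \<rho>1] assms \<rho> by force
    then have "- M \<le> \<rho>1 z \<and> \<rho>1 z \<le> - c" using assms by (intro \<rho>1_bounds) auto
    then have "(y - x) * (- M) \<le> (y - x) * \<rho>1 z" "(y - x) * \<rho>1 z \<le> (y - x) * (- c)"
      using assms by (intro mult_left_mono; simp)+
    then show ?thesis using z by (auto simp: algebra_simps)
  qed auto
  then show "c * (y - x) \<le> \<rho> x - \<rho> y" "\<rho> x - \<rho> y \<le> M * (y - x)" by auto
qed

lemma F_increment:
  assumes "N \<le> x" "x \<le> y" "y \<le> N + 2 * L"
  shows "F1 N * (y - x) \<le> F y - F x"
proof (cases "x = y")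
  case False
  then obtain z where z: "x < z" "z < y" "F y - F x = (y - x) * F1 z"
    using MVT2[of x y F F1] assms F by force
  have "F1 N \<le> F1 z" using z assms by (intro F1_ge) auto
  with assms show ?thesis by (simp add: z mult.commute[of "F1 N"] mult_left_mono)
qed auto

text \<open>A Cauchy mean value estimate: the increments of \<open>F1\<close> and \<open>F\<close>
  have a quotient between \<open>\<rho> y\<close> and \<open>\<rho> x\<close>. It follows from the
  sign of the derivative of \<open>F1 - a * F\<close> for \<open>a = \<rho> x\<close> and
  \<open>a = \<rho> y\<close>, as \<open>\<rho>\<close> decreases.\<close>

lemma F1_increment:
  assumes "N \<le> x" "x \<le> y" "y \<le> N + 2 * L"
  shows "F1 y - F1 x \<le> \<rho> x * (F y - F x)" "\<rho> y * (F y - F x) \<le> F1 y - F1 x"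
proof -
  have D: "((\<lambda>z. F1 z - a * F z) has_real_derivative F1 z * (\<rho> z - a)) (at z)"
    if "z \<in> {x..y}" for a z
    using that assms by (auto intro!: derivative_eq_intros F1 F simp: algebra_simps)
  have "F1 y - \<rho> x * F y \<le> F1 x - \<rho> x * F x"
  proof (rule DERIV_nonpos_imp_nonincreasing[OF assms(2)])
    fix z assume z: "x \<le> z" "z \<le> y"
    have "\<rho> z \<le> \<rho> x" using \<rho>_diff(1)[of x z] z assms c_pos by (smt (verit) mult_nonneg_nonneg)
    then have "F1 z * (\<rho> z - \<rho> x) \<le> 0"
      using F1_pos[of z] z assms by (simp add: mult_nonneg_nonpos)
    then show "\<exists>w. ((\<lambda>z. F1 z - \<rho> x * F z) has_real_derivative w) (at z) \<and> w \<le> 0"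
      using D z by (metis atLeastAtMost_iff)
  qed
  then show "F1 y - F1 x \<le> \<rho> x * (F y - F x)" by (simp add: algebra_simps)
  have "F1 x - \<rho> y * F x \<le> F1 y - \<rho> y * F y"
  proof (rule DERIV_nonneg_imp_nondecreasing[OF assms(2)])
    fix z assume z: "x \<le> z" "z \<le> y"
    have "\<rho> y \<le> \<rho> z" using \<rho>_diff(1)[of z y] z assms c_pos by (smt (verit) mult_nonneg_nonneg)
    then have "F1 z * (\<rho> z - \<rho> y) \<ge> 0"
      using F1_pos[of z] z assms by (simp)
    then show "\<exists>w. ((\<lambda>z. F1 z - \<rho> y * F z) has_real_derivative w) (at z) \<and> 0 \<le> w"
      using D z by (metis atLeastAtMost_iff)
  qed
  then show "\<rho> y * (F y - F x) \<le> F1 y - F1 x" by (simp add: algebra_simps)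
qed

text \<open>The expression in \<open>W\<close> equals \<open>F (x + s + d) - F (x + t)\<close> minus
  the second difference of \<open>F\<close> with steps \<open>d\<close> and \<open>s\<close>. Mean
  values turn these into \<open>(s + d - t) * F1 \<eta>\<close> and
  \<open>s * d * F1 \<xi> * \<rho> \<xi>\<close>; division by \<open>F1 \<eta>\<close> leaves the
  factor \<open>\<kappa>\<close> close to 1.\<close>

lemma defect_formula:
  assumes "N \<le> x" "0 < d" "0 < s" "0 \<le> t" "x + s + d \<le> N + 2 * L" "x + t \<le> N + 2 * L"
    and W: "\<bar>F (x + d) + F (x + s) - F x - F (x + t)\<bar> \<le> W"
  obtains \<xi> \<kappa> where "\<xi> \<in> {N..N + 2 * L}" "\<bar>\<kappa> - 1\<bar> \<le> 4 * L * r"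
    "\<bar>s + d - t - d * s * (\<rho> \<xi> * \<kappa>)\<bar> \<le> W / F1 N"
proof -
  have "\<exists>z>x. z < x + s \<and>
      (F (x + s + d) - F (x + s)) - (F (x + d) - F x) = (x + s - x) * (F1 (z + d) - F1 z)"
  proof (rule MVT2)
    fix y assume "x \<le> y" "y \<le> x + s"
    then show "((\<lambda>y. F (y + d) - F y) has_real_derivative F1 (y + d) - F1 y) (at y)"
      using assms by (auto intro!: derivative_eq_intros F_shift F)
  qed (use assms in simp)
  then obtain z where z: "x < z" "z < x + s"
    "(F (x + s + d) - F (x + s)) - (F (x + d) - F x) = s * (F1 (z + d) - F1 z)" by auto
  obtain \<xi> where \<xi>: "z < \<xi>" "\<xi> < z + d" "F1 (z + d) - F1 z = (z + d - z) * (F1 \<xi> * \<rho> \<xi>)"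
    using MVT2[of z "z + d" F1 "\<lambda>y. F1 y * \<rho> y"] F1 z assms by auto
  have \<xi>_in: "\<xi> \<in> {N..N + 2 * L}" using \<xi> z assms by auto
  obtain \<eta> where \<eta>: "\<eta> \<in> {N..N + 2 * L}" "F (x + s + d) - F (x + t) = (s + d - t) * F1 \<eta>"
  proof -
    \<comment> \<open>The mean value theorem needs the order of the endpoints. If they coincide,
      both sides vanish and any point will do.\<close>
    consider "s + d < t" | "s + d = t" | "t < s + d" by linarith
    then show thesis
    proof cases
      case 1
      then obtain w where w: "x + s + d < w" "w < x + t"
          "F (x + t) - F (x + s + d) = (x + t - (x + s + d)) * F1 w"
        using MVT2[of "x + s + d" "x + t" F F1] F assms by auto
      show thesis by (rule that[of w]) (use w assms in \<open>auto simp: algebra_simps\<close>)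
    next
      case 2
      show thesis by (rule that[of N]) (use 2 assms in \<open>auto simp: algebra_simps\<close>)
    next
      case 3
      then obtain w where w: "x + t < w" "w < x + s + d"
          "F (x + s + d) - F (x + t) = (x + s + d - (x + t)) * F1 w"
        using MVT2[of "x + t" "x + s + d" F F1] F assms by auto
      show thesis by (rule that[of w]) (use w assms in \<open>auto simp: algebra_simps\<close>)
    qed
  qed
  define \<kappa> where "\<kappa> = F1 \<xi> / F1 \<eta>"
  have pos: "0 < F1 \<xi>" "0 < F1 \<eta>" using F1_pos \<xi>_in \<eta>(1) by auto
  have up: "\<kappa> \<le> 1 + 4 * L * r"
    using F1_ratio[OF \<eta>(1) \<xi>_in] pos by (simp add: \<kappa>_def divide_le_eq mult.commute)
  have "1 \<le> \<kappa> * (1 + 4 * L * r)"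
    using F1_ratio[OF \<xi>_in \<eta>(1)] pos by (simp add: \<kappa>_def field_simps)
  \<comment> \<open>This turns the reversed ratio bound,
    \<open>1 / (1 + 4 * L * r) \<le> \<kappa>\<close>, into a linear lower bound.\<close>
  moreover have "(1 - 4 * L * r) * (1 + 4 * L * r) \<le> 1"
    using zero_le_square[of "L * r"] by argo
  ultimately have "(1 - 4 * L * r) * (1 + 4 * L * r) \<le> \<kappa> * (1 + 4 * L * r)" by linarith
  moreover have "0 < 1 + 4 * L * r" using r_nonneg L_pos by (simp add: add_pos_nonneg)
  ultimately have low: "1 - 4 * L * r \<le> \<kappa>" by (simp add: mult_le_cancel_right)
  have "F (x + d) + F (x + s) - F x - F (x + t) = (s + d - t) * F1 \<eta> - s * (d * (F1 \<xi> * \<rho> \<xi>))"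
    using z(3) \<xi>(3) \<eta>(2) by simp
  also have "\<dots> = (s + d - t - d * s * (\<rho> \<xi> * \<kappa>)) * F1 \<eta>"
    using pos by (simp add: \<kappa>_def algebra_simps)
  finally have "\<bar>s + d - t - d * s * (\<rho> \<xi> * \<kappa>)\<bar> * F1 \<eta> \<le> W"
    using W pos by (simp add: abs_mult)
  then have "\<bar>s + d - t - d * s * (\<rho> \<xi> * \<kappa>)\<bar> \<le> W / F1 \<eta>"
    using pos by (simp add: field_simps)
  also have "\<dots> \<le> W / F1 N"
    using F1_ge[OF \<eta>(1)] F1_N_pos W_nonneg by (intro divide_left_mono) auto
  finally show thesis using that[of \<xi> \<kappa>] \<xi>_in up low by auto
qed

text \<open>Both \<open>t\<close> and \<open>t'\<close> are within \<open>W / F1 N\<close> of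
  \<open>s + d - d * s * (\<rho> \<xi> * \<kappa>)\<close> at their own points. Over the window
  \<open>\<rho>\<close> varies by at most \<open>2 * L * M\<close> and \<open>\<kappa>\<close> by at
  most \<open>8 * L * r\<close>, so the two values differ by less than 1. For integers this is
  equality.\<close>

lemma outer_gap_determined:
  assumes "0 < d" "d \<le> L" "0 < s" "s \<le> L"
    and "N \<le> x" "0 \<le> t" "x + s + d \<le> N + 2 * L" "x + t \<le> N + 2 * L"
    and "\<bar>F (x + d) + F (x + s) - F x - F (x + t)\<bar> \<le> W"
    and "N \<le> x'" "0 \<le> t'" "x' + s + d \<le> N + 2 * L" "x' + t' \<le> N + 2 * L"
    and "\<bar>F (x' + d) + F (x' + s) - F x' - F (x' + t')\<bar> \<le> W"
  shows "\<bar>t - t'\<bar> < 1"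
proof -
  obtain \<xi> \<kappa> where 1: "\<xi> \<in> {N..N + 2 * L}" "\<bar>\<kappa> - 1\<bar> \<le> 4 * L * r"
    "\<bar>s + d - t - d * s * (\<rho> \<xi> * \<kappa>)\<bar> \<le> W / F1 N"
    using defect_formula[of x d s t] assms by metis
  obtain \<xi>' \<kappa>' where 2: "\<xi>' \<in> {N..N + 2 * L}" "\<bar>\<kappa>' - 1\<bar> \<le> 4 * L * r"
    "\<bar>s + d - t' - d * s * (\<rho> \<xi>' * \<kappa>')\<bar> \<le> W / F1 N"
    using defect_formula[of x' d s t'] assms by metis
  have \<rho>\<rho>: "\<bar>\<rho> \<xi> - \<rho> \<xi>'\<bar> \<le> M * (2 * L)"
  proof -
    have "\<rho> a - \<rho> b \<le> M * (2 * L) \<and> \<rho> b - \<rho> a \<le> M * (2 * L)" if "N \<le> a" "a \<le> b" "b \<le> N + 2 * L" for a b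
    proof -
      have "\<rho> a - \<rho> b \<le> M * (b - a)" "0 \<le> M * (b - a)" "c * (b - a) \<le> \<rho> a - \<rho> b" "0 \<le> c * (b - a)"
        using \<rho>_diff[of a b] that M_pos c_pos by auto
      moreover have "M * (b - a) \<le> M * (2 * L)" using that M_pos by (intro mult_left_mono) auto
      ultimately show ?thesis by linarith
    qed
    from this[of \<xi> \<xi>'] this[of \<xi>' \<xi>] show ?thesis using 1(1) 2(1) by (cases "\<xi> \<le> \<xi>'") auto
  qed
  have \<kappa>3: "\<bar>\<kappa>\<bar> \<le> 3" using 1(2) Lr by linarith
  have "\<rho> \<xi> * \<kappa> - \<rho> \<xi>' * \<kappa>' = (\<rho> \<xi> - \<rho> \<xi>') * \<kappa> + \<rho> \<xi>' * (\<kappa> - \<kappa>')"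
    by (simp add: algebra_simps)
  also have "\<bar>\<dots>\<bar> \<le> \<bar>\<rho> \<xi> - \<rho> \<xi>'\<bar> * \<bar>\<kappa>\<bar> + \<bar>\<rho> \<xi>'\<bar> * \<bar>\<kappa> - \<kappa>'\<bar>"
    by (metis abs_mult abs_triangle_ineq)
  also have "\<dots> \<le> (M * (2 * L)) * 3 + r * (8 * L * r)"
    using \<rho>\<rho> \<kappa>3 \<rho>_bounds[OF 2(1)] M_pos L_pos 1(2) 2(2) r_nonneg by (intro add_mono mult_mono) auto
  finally have diff: "\<bar>\<rho> \<xi> * \<kappa> - \<rho> \<xi>' * \<kappa>'\<bar> \<le> L * (6 * M + 8 * r\<^sup>2)"
    by (simp add: algebra_simps power2_eq_square)
  have "\<bar>d * s * (\<rho> \<xi> * \<kappa>) - d * s * (\<rho> \<xi>' * \<kappa>')\<bar> = d * s * \<bar>\<rho> \<xi> * \<kappa> - \<rho> \<xi>' * \<kappa>'\<bar>"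
    using assms(1,3) by (simp add: abs_mult flip: right_diff_distrib)
  also have "\<dots> \<le> (L * L) * (L * (6 * M + 8 * r\<^sup>2))"
    using assms(1-4) diff by (intro mult_mono) auto
  also have "\<dots> = L ^ 3 * (6 * M + 8 * r\<^sup>2)" by (simp add: power3_eq_cube)
  finally show ?thesis using 1(3) 2(3) curvature_small by linarith
qed

text \<open>\<open>P\<close> is the logarithm of the quotient of outer and inner increment. It is
  nearly 0 at an approximate solution, but it falls at rate at least \<open>c\<close>, hence by at
  least \<open>c\<close> between \<open>x\<close> and \<open>y\<close>, which \<open>W_small\<close>
  rules out.\<close>

lemma base_point_determined:
  assumes "N \<le> x" "x + 1 \<le> y" "y + t \<le> N + 2 * L" "1 \<le> d" "d + 1 \<le> s" "s + 1 \<le> t"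
    and x: "\<bar>F (x + d) + F (x + s) - F x - F (x + t)\<bar> \<le> W"
    and y: "\<bar>F (y + d) + F (y + s) - F y - F (y + t)\<bar> \<le> W"
  shows False
proof -
  define P where "P z = ln (F (z + t) - F (z + s)) - ln (F (z + d) - F z)" for z
  have ran: "z \<in> {N..N + 2 * L}" "z + d \<in> {N..N + 2 * L}" "z + s \<in> {N..N + 2 * L}" 
     "z + t \<in> {N..N + 2 * L}" if "z \<in> {x..y}" for z using assms that by auto
  have pos: "F1 N \<le> F (z + d) - F z" "F1 N \<le> F (z + t) - F (z + s)" if z: "z \<in> {x..y}" for z
  proof -
    have "F1 N * 1 \<le> F1 N * d" "F1 N * 1 \<le> F1 N * (t - s)" 
      using F1_N_pos assms by (intro mult_left_mono; simp)+
    moreover have "F1 N * d \<le> F (z + d) - F z" "F1 N * (t - s) \<le> F (z + t) - F (z + s)"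
      using F_increment[of z "z + d"] F_increment[of "z + s" "z + t"] ran[OF z] assms by auto
    ultimately show "F1 N \<le> F (z + d) - F z" "F1 N \<le> F (z + t) - F (z + s)" by linarith+
  qed
  have P_small: "\<bar>P z\<bar> \<le> 2 * (W / F1 N)" 
    if z: "z \<in> {x..y}" and zW: "\<bar>F (z + d) + F (z + s) - F z - F (z + t)\<bar> \<le> W" for z
  proof -
    define A B where "A = F (z + d) - F z" and "B = F (z + t) - F (z + s)"
    have AB: "0 < A" "0 < B" "F1 N \<le> A" using pos[OF z] F1_N_pos by (auto simp: A_def B_def)
    define v where "v = B / A - 1"
    have "\<bar>v\<bar> = \<bar>B - A\<bar> / A" using AB by (simp add: v_def field_simps)
    also have "\<dots> \<le> W / F1 N"
      using zW AB F1_N_pos by (intro frac_le) (auto simp: A_def B_def)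
    finally have v: "\<bar>v\<bar> \<le> W / F1 N" .
    have "P z = ln (1 + v)" using AB by (simp add: P_def v_def ln_div flip: A_def B_def)
    \<comment> \<open>From \<open>\<bar>v\<bar> \<le> 1 / 4\<close>: the quadratic error
      \<open>2 * v^2\<close> is at most half of \<open>\<bar>v\<bar>\<close>.\<close>
    moreover have "\<bar>ln (1 + v)\<bar> \<le> 2 * \<bar>v\<bar>" 
      using abs_ln_one_plus_x_minus_x_bound[of v] v W_small(1)
    proof -
      have v4: "\<bar>v\<bar> \<le> 1 / 4" using v W_small(1) by linarith
      then have "\<bar>ln (1 + v) - v\<bar> \<le> 2 * v\<^sup>2" by (intro abs_ln_one_plus_x_minus_x_bound) auto
      moreover have "v\<^sup>2 = \<bar>v\<bar> * \<bar>v\<bar>" by (simp add: power2_eq_square)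
      moreover have "\<bar>v\<bar> * \<bar>v\<bar> \<le> (1/4) * \<bar>v\<bar>" using v4 by (intro mult_right_mono) auto
      ultimately show ?thesis by linarith
    qed
    ultimately show ?thesis using v by linarith
  qed
  define P' where "P' z = (F1 (z + t) - F1 (z + s)) / (F (z + t) - F (z + s))
      - (F1 (z + d) - F1 z) / (F (z + d) - F z)" for z
  have "\<exists>z. x < z \<and> z < y \<and> P y - P x = (y - x) * P' z"
  proof (rule MVT2)
    show "x < y" using assms by auto
    fix z assume "x \<le> z" "z \<le> y"
    then have z: "z \<in> {x..y}" by auto
    show "(P has_real_derivative P' z) (at z)"
    proof -
      have p: "0 < F (z + t) - F (z + s)" "0 < F (z + d) - F z"
        using pos[OF z] F1_N_pos by linarith+
      have D: "((\<lambda>z. F (z + t) - F (z + s)) has_real_derivative F1 (z + t) - F1 (z + s)) (at z)"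
        "((\<lambda>z. F (z + d) - F z) has_real_derivative F1 (z + d) - F1 z) (at z)"
        by (intro DERIV_diff F_shift F ran[OF z])+
      show ?thesis
        using DERIV_diff[OF DERIV_chain2[OF DERIV_ln_divide[OF p(1)] D(1)]
            DERIV_chain2[OF DERIV_ln_divide[OF p(2)] D(2)]]
        unfolding P_def[abs_def] P'_def by simp
    qed
  qed
  then obtain z where z: "x < z" "z < y" "P y - P x = (y - x) * P' z" by auto
  then have zin: "z \<in> {x..y}" by auto
  note R = ran[OF zin]
  \<comment> \<open>Each quotient is compared with \<open>\<rho>\<close> at the endpoint facing the
    other interval; these endpoints \<open>z + d\<close> and \<open>z + s\<close> are at least 1
    apart.\<close>
  have "(F1 (z + t) - F1 (z + s)) / (F (z + t) - F (z + s)) \<le> \<rho> (z + s)"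
    using F1_increment(1)[of "z + s" "z + t"] R assms pos(2)[OF zin] F1_N_pos
    by (simp add: divide_le_eq)
  moreover have "\<rho> (z + d) \<le> (F1 (z + d) - F1 z) / (F (z + d) - F z)"
    using F1_increment(2)[of "z" "z + d"] R assms pos(1)[OF zin] F1_N_pos
    by (simp add: le_divide_eq)
  moreover have "c * ((z + s) - (z + d)) \<le> \<rho> (z + d) - \<rho> (z + s)"
    using \<rho>_diff(1)[of "z + d" "z + s"] R assms by auto
  moreover have "c * 1 \<le> c * ((z + s) - (z + d))"
    using assms c_pos by (intro mult_left_mono) auto
  ultimately have P': "P' z \<le> - c" by (simp add: P'_def)
  have "(y - x) * P' z \<le> 1 * P' z" 
    using P' c_pos assms by (intro mult_right_mono_neg) auto
  with P' z have "P y - P x \<le> - c" by auto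
  moreover have "\<bar>P x\<bar> \<le> 2 * (W / F1 N)" "\<bar>P y\<bar> \<le> 2 * (W / F1 N)"
    using P_small[of x] P_small[of y] x y assms by auto
  ultimately show False using W_small(2) by auto
qed

end

section \<open>Counting the approximate solutions by cases\<close>

lemma card_le_cover:
  assumes "A \<subseteq> \<Union> (set Bs)" "\<And>B. B \<in> set Bs \<Longrightarrow> finite B \<and> card B \<le> b"
  shows "card A \<le> length Bs * b"
proof -
  have "card A \<le> card (\<Union> (set Bs))"
    using assms by (intro card_mono) auto
  also have "\<dots> \<le> length Bs * b"
    using assms(2)
  proof (induction Bs)
    case (Cons B Bs)
    have "card (B \<union> \<Union> (set Bs)) \<le> card B + card (\<Union> (set Bs))" by (rule card_Un_le)
    also have "\<dots> \<le> b + length Bs * b" using Cons by (intro add_mono) auto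
    finally show ?case by simp
  qed auto
  finally show ?thesis .
qed

lemma card_le_square:
  assumes "inj_on f A" "f ` A \<subseteq> B \<times> B" "finite B"
  shows "finite A \<and> card A \<le> (card B)\<^sup>2"
proof -
  have "finite (f ` A)" using assms(2,3) finite_subset by blast
  then have "finite A" using assms(1) by (simp add: finite_image_iff)
  moreover have "card A = card (f ` A)" using assms(1) by (simp add: card_image)
  moreover have "card (f ` A) \<le> card (B \<times> B)" using assms by (intro card_mono) auto
  ultimately show ?thesis by (simp add: power2_eq_square card_cartesian_product)
qed

text \<open>The 14 classes are six kinds of coincidence between two indices and eight orderings of
  four distinct indices. In each class two parameters fix the solution, so each has at most
  \<open>L0^2\<close> elements.\<close>

lemma (in convex_block) quasi_energy_le:
  assumes N: "N = real N0" and L: "L = real L0"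
  shows "quasi_energy (\<lambda>n. F (real n)) {N0 + 1..N0 + L0} W \<le> 14 * L0\<^sup>2"
proof -
  define B where "B = {N0 + 1..N0 + L0}"
  define f where "f n = F (real n)" for n :: nat
  define Q where "Q k l m n \<longleftrightarrow> k \<in> B \<and> l \<in> B \<and> m \<in> B \<and> n \<in> B \<and> \<bar>f k + f l - f m - f n\<bar> \<le> W" for k l m n
  \<comment> \<open>The tuples list the indices in increasing order, unlike the arguments of
    \<open>Q\<close>.\<close>
  define X where "X = {(m, k, l, n). m < k \<and> k < l \<and> l < n \<and> Q k l m n}"
  have WA: "4 * W \<le> F1 N" using W_small(1) F1_N_pos by (simp add: field_simps)
  have gap: "f i + F1 N \<le> f j" if "i \<in> B" "j \<in> B" "i < j" for i j
  proof -
    have "F1 N * 1 \<le> F1 N * (real j - real i)"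
      using F1_N_pos that by (intro mult_left_mono) auto
    also have "\<dots> \<le> f j - f i" 
      unfolding f_def using that by (intro F_increment) (auto simp: B_def N L)
    finally show ?thesis by simp
  qed
  \<comment> \<open>The bound is \<open>2 * W\<close> since subtracting two solutions that share all
    indices but one doubles the tolerance.\<close>
  have eq: "i = j" if "i \<in> B" "j \<in> B" "\<bar>f i - f j\<bar> \<le> 2 * W" for i j
    using gap[of i j] gap[of j i] that WA F1_N_pos W_nonneg by (cases i j rule: linorder_cases) auto
  have B: "finite B" "card B = L0" by (auto simp: B_def)
  have X_real: "real k = m + real (k - m)" "real l = m + real (l - m)" "real n = m + real (n - m)"
      "1 \<le> real (k - m)" "real (k - m) + 1 \<le> real (l - m)" "real (l - m) + 1 \<le> real (n - m)"
      "real (l - m) \<le> L" "N \<le> m" "m + real (n - m) \<le> N + L"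
      "\<bar>F (m + real (k - m)) + F (m + real (l - m)) - F m - F (m + real (n - m))\<bar> \<le> W"
    if "(m, k, l, n) \<in> X" for m k l n
  proof -
    have ord: "m < k" "k < l" "l < n" and mn: "N0 + 1 \<le> m" "n \<le> N0 + L0"
      and W: "\<bar>f k + f l - f m - f n\<bar> \<le> W"
      using that by (auto simp: X_def Q_def B_def)
    then show eqs: "real k = m + real (k - m)" "real l = m + real (l - m)" "real n = m + real (n - m)"
      by auto
    show "\<bar>F (m + real (k - m)) + F (m + real (l - m)) - F m - F (m + real (n - m))\<bar> \<le> W"
      using W unfolding f_def eqs[symmetric] .
    show "1 \<le> real (k - m)" "real (k - m) + 1 \<le> real (l - m)" "real (l - m) + 1 \<le> real (n - m)"
      "real (l - m) \<le> L" "N \<le> m" "m + real (n - m) \<le> N + L"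
      using ord mn unfolding N L by linarith+
  qed
  have X_gap: "n - m = n' - m'" if x: "(m, k, l, n) \<in> X" and x': "(m', k', l', n') \<in> X"
      and eq: "k - m = k' - m'" "l - m = l' - m'" for m k l n m' k' l' n'
  proof -
    note r = X_real[OF x] X_real[OF x', folded eq]
    have "\<bar>real (n - m) - real (n' - m')\<bar> < 1"
      by (rule outer_gap_determined[OF _ _ _ _ _ _ _ _ r(10) _ _ _ _ r(20)]) (use r(4-9) r(14-19) in linarith)+
    then show ?thesis by linarith
  qed
  have X_base: "\<not> m < m'" if x: "(m, k, l, n) \<in> X" and x': "(m', k', l', n') \<in> X"
      and eq: "k - m = k' - m'" "l - m = l' - m'" for m k l n m' k' l' n'
  proof
    assume "m < m'"
    then have mm: "real m + 1 \<le> real m'" by linarith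
    note r = X_real[OF x] X_real[OF x', folded eq X_gap[OF x x' eq]]
    show False
      by (rule base_point_determined[OF _ mm _ _ _ _ r(10) r(20)]) (use r(4-9) r(14-19) L_pos in linarith)+
  qed
  \<comment> \<open>The two inner gaps fix the outer gap by \<open>X_gap\<close> and then the base
    point by \<open>X_base\<close>, applied in both directions.\<close>
  have "inj_on (\<lambda>(m, k, l, n). (k - m, l - m)) X"
  proof (rule inj_onI)
    fix a b
    assume ab: "a \<in> X" "b \<in> X" "(\<lambda>(m, k, l, n). (k - m, l - m)) a = (\<lambda>(m, k, l, n). (k - m, l - m)) b"
    obtain m k l n where a: "a = (m, k, l, n)" by (rule prod_cases4)
    obtain m' k' l' n' where b: "b = (m', k', l', n')" by (rule prod_cases4)
    have *: "(m, k, l, n) \<in> X" "(m', k', l', n') \<in> X" "k - m = k' - m'" "l - m = l' - m'"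
      using ab by (auto simp: a b)
    have "m = m'" using X_base[OF *] X_base[OF *(2,1) *(3,4)[symmetric]] by simp
    then show "a = b"
      using * X_gap[OF *] by (auto simp: X_def a b)
  qed
  moreover have "(\<lambda>(m, k, l, n). (k - m, l - m)) ` X \<subseteq> {1..L0} \<times> {1..L0}"
    by (auto simp: X_def Q_def B_def)
  ultimately have X: "finite X \<and> card X \<le> L0\<^sup>2"
    using card_le_square[of _ X "{1..L0}"] by simp
  have coincidence: "finite S \<and> card S \<le> L0\<^sup>2" if "inj_on p S" "p ` S \<subseteq> B \<times> B" for S :: "(nat \<times> nat \<times> nat \<times> nat) set" and p :: "nat \<times> nat \<times> nat \<times> nat \<Rightarrow> nat \<times> nat"
    using card_le_square[of p S B] that B by simp
  define Bs where "Bs = [{(k, l, m, n). Q k l m n \<and> k = l}, {(k, l, m, n). Q k l m n \<and> m = n},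
    {(k, l, m, n). Q k l m n \<and> k = m}, {(k, l, m, n). Q k l m n \<and> k = n},
    {(k, l, m, n). Q k l m n \<and> l = m}, {(k, l, m, n). Q k l m n \<and> l = n},
    (\<lambda>(m, k, l, n). (k, l, m, n)) ` X, (\<lambda>(m, k, l, n). (l, k, m, n)) ` X,
    (\<lambda>(m, k, l, n). (k, l, n, m)) ` X, (\<lambda>(m, k, l, n). (l, k, n, m)) ` X,
    (\<lambda>(m, k, l, n). (m, n, k, l)) ` X, (\<lambda>(m, k, l, n). (m, n, l, k)) ` X,
    (\<lambda>(m, k, l, n). (n, m, k, l)) ` X, (\<lambda>(m, k, l, n). (n, m, l, k)) ` X]"
  have "finite S \<and> card S \<le> L0\<^sup>2" if "S \<in> set Bs" for S
  proof -
    have img: "finite (h ` X) \<and> card (h ` X) \<le> L0\<^sup>2" for h :: "_ \<Rightarrow> nat \<times> nat \<times> nat \<times> nat"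
      using X card_image_le[of X h] by auto
    have 1: "finite {(k, l, m, n). Q k l m n \<and> k = l} \<and> card {(k, l, m, n). Q k l m n \<and> k = l} \<le> L0\<^sup>2"
      by (rule coincidence[of "\<lambda>(k, l, m, n). (k, m)"]; fastforce simp: Q_def intro!: inj_onI eq)
    have 2: "finite {(k, l, m, n). Q k l m n \<and> m = n} \<and> card {(k, l, m, n). Q k l m n \<and> m = n} \<le> L0\<^sup>2"
      by (rule coincidence[of "\<lambda>(k, l, m, n). (k, m)"]; fastforce simp: Q_def intro!: inj_onI eq)
    have 3: "finite {(k, l, m, n). Q k l m n \<and> k = m} \<and> card {(k, l, m, n). Q k l m n \<and> k = m} \<le> L0\<^sup>2"
      by (rule coincidence[of "\<lambda>(k, l, m, n). (k, l)"]; fastforce simp: Q_def intro!: inj_onI eq)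
    have 4: "finite {(k, l, m, n). Q k l m n \<and> k = n} \<and> card {(k, l, m, n). Q k l m n \<and> k = n} \<le> L0\<^sup>2"
      by (rule coincidence[of "\<lambda>(k, l, m, n). (k, l)"]; fastforce simp: Q_def intro!: inj_onI eq)
    have 5: "finite {(k, l, m, n). Q k l m n \<and> l = m} \<and> card {(k, l, m, n). Q k l m n \<and> l = m} \<le> L0\<^sup>2"
      by (rule coincidence[of "\<lambda>(k, l, m, n). (k, l)"]; fastforce simp: Q_def intro!: inj_onI eq)
    have 6: "finite {(k, l, m, n). Q k l m n \<and> l = n} \<and> card {(k, l, m, n). Q k l m n \<and> l = n} \<le> L0\<^sup>2"
      by (rule coincidence[of "\<lambda>(k, l, m, n). (k, l)"]; fastforce simp: Q_def intro!: inj_onI eq)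
    from that show ?thesis unfolding Bs_def list.set insert_iff empty_iff
      by (elim disjE FalseE) (simp_all only: 1 2 3 4 5 6 img)
  qed
  moreover have "{(k, l, m, n) \<in> B \<times> B \<times> B \<times> B. \<bar>f k + f l - f m - f n\<bar> \<le> W} \<subseteq> \<Union> (set Bs)"
  proof clarify
    fix k l m n assume in_B: "k \<in> B" "l \<in> B" "m \<in> B" "n \<in> B" and W: "\<bar>f k + f l - f m - f n\<bar> \<le> W"
    have Q: "Q k l m n" "Q l k m n" "Q k l n m" "Q l k n m" "Q m n k l" "Q n m k l" "Q m n l k" "Q n m l k"
      using in_B W unfolding Q_def by auto
    \<comment> \<open>One side would then exceed the other by at least \<open>2 * F1 N\<close>, far
      more than \<open>W\<close>.\<close>
    have no: "\<not> (a < c \<and> b < d)" if "Q a b c d" for a b c d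
      using that gap[of a c] gap[of b d] WA F1_N_pos unfolding Q_def by auto
    show "(k, l, m, n) \<in> \<Union> (set Bs)"
    proof (cases "k = l \<or> m = n \<or> k = m \<or> k = n \<or> l = m \<or> l = n")
      case True
      then show ?thesis unfolding Bs_def using Q by auto
    next
      case False
      \<comment> \<open>By \<open>no\<close>, the smallest and the largest index stand on the same
        side of the equation, which leaves 8 of the 24 orderings.\<close>
      have "(m < k \<and> k < l \<and> l < n) \<or> (m < l \<and> l < k \<and> k < n) \<or>
         (n < k \<and> k < l \<and> l < m) \<or> (n < l \<and> l < k \<and> k < m) \<or>
         (k < m \<and> m < n \<and> n < l) \<or> (k < n \<and> n < m \<and> m < l) \<or>
         (l < m \<and> m < n \<and> n < k) \<or> (l < n \<and> n < m \<and> m < k)"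
        using no[OF Q(1)] no[OF Q(2)] no[OF Q(5)] no[OF Q(6)] False by (smt (verit) linorder_neqE_nat)
      then have "(m, k, l, n) \<in> X \<or> (m, l, k, n) \<in> X \<or> (n, k, l, m) \<in> X \<or> (n, l, k, m) \<in> X \<or>
         (k, m, n, l) \<in> X \<or> (k, n, m, l) \<in> X \<or> (l, m, n, k) \<in> X \<or> (l, n, m, k) \<in> X"
        unfolding X_def using Q by auto
      then show ?thesis unfolding Bs_def by (elim disjE) (force simp: image_iff)+
    qed
  qed
  ultimately have "card {(k, l, m, n) \<in> B \<times> B \<times> B \<times> B. \<bar>f k + f l - f m - f n\<bar> \<le> W} \<le> length Bs * L0\<^sup>2"
    by (intro card_le_cover) auto
  then show ?thesis by (simp add: quasi_energy_def Bs_def B_def f_def)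
qed

subsection \<open>The functions \<open>exp (\<gamma> (ln x)\<^sup>\<beta>)\<close>\<close>

locale log_power_growth =
  fixes \<gamma> \<beta> :: real
  assumes \<gamma>: "\<gamma> > 0" and \<beta>: "1 < \<beta>" "\<beta> \<le> 2"
begin

definition F :: "real \<Rightarrow> real" where
  "F x = exp (\<gamma> * ln x powr \<beta>)"

definition F1 :: "real \<Rightarrow> real" where
  "F1 x = F x * (\<gamma> * \<beta> * ln x powr (\<beta> - 1) / x)"

text \<open>The logarithmic derivative of \<open>F1\<close>: the sum of those of \<open>F\<close>,
  of the power of \<open>ln x\<close> and of \<open>1 / x\<close>.\<close>

definition \<rho> :: "real \<Rightarrow> real" where
  "\<rho> x = (\<gamma> * \<beta> * ln x powr (\<beta> - 1) - 1 + (\<beta> - 1) / ln x) / x"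

definition \<rho>1 :: "real \<Rightarrow> real" where
  "\<rho>1 x = (\<gamma> * \<beta> * (\<beta> - 1) * ln x powr (\<beta> - 2) - (\<beta> - 1) / (ln x)\<^sup>2
           - (\<gamma> * \<beta> * ln x powr (\<beta> - 1) - 1 + (\<beta> - 1) / ln x)) / x\<^sup>2"

lemma F_deriv:
  assumes "1 < x"
  shows "(F has_real_derivative F1 x) (at x)"
  using assms unfolding F_def[abs_def] F1_def
  by (auto intro!: derivative_eq_intros simp: field_simps powr_diff)

lemma F1_deriv:
  assumes "1 < x"
  shows "(F1 has_real_derivative F1 x * \<rho> x) (at x)"
  using assms unfolding F1_def[abs_def] 
  by (auto intro!: derivative_eq_intros F_deriv simp: \<rho>_def F1_def)
     (simp add: field_simps powr_diff power2_eq_square)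

lemma \<rho>_deriv:
  assumes "1 < x"
  shows "(\<rho> has_real_derivative \<rho>1 x) (at x)"
  using assms unfolding \<rho>_def[abs_def] \<rho>1_def
  by (auto intro!: derivative_eq_intros) (simp add: field_simps powr_diff power2_eq_square)

text \<open>Since \<open>\<beta> > 1\<close>, \<open>F\<close> outgrows every power. The exponent 10
  is ample: at \<open>x = q^7\<close> it gives \<open>q^70\<close>, against a tolerance of order
  \<open>q^16\<close>.\<close>

lemma F1_lower: "eventually (\<lambda>x. x ^ 10 \<le> F1 x) at_top"
  unfolding F1_def F_def using \<gamma> \<beta> by real_asymp

text \<open>\<open>\<rho>\<close> has the order of \<open>1 / x\<close> times a power of
  \<open>ln x\<close>. The loss of \<open>1 / 14\<close> in the exponent absorbs the logarithm and
  becomes \<open>q powr (- 13 / 2)\<close> at \<open>x = q^7\<close>.\<close>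

lemma \<rho>_upper: "eventually (\<lambda>x. 0 \<le> \<rho> x \<and> \<rho> x \<le> x powr (- 13 / 14)) at_top"
  unfolding \<rho>_def using \<gamma> \<beta> by (intro eventually_conj; real_asymp)

text \<open>The numerator is dominated by
  \<open>- \<gamma> * \<beta> * ln x powr (\<beta> - 1)\<close> and tends to minus infinity.\<close>

lemma \<rho>1_upper: "eventually (\<lambda>x. \<rho>1 x \<le> - 1 / x\<^sup>2) at_top"
proof -
  have "eventually (\<lambda>x. \<gamma> * \<beta> * (\<beta> - 1) * ln x powr (\<beta> - 2) - (\<beta> - 1) / (ln x)\<^sup>2
           - (\<gamma> * \<beta> * ln x powr (\<beta> - 1) - 1 + (\<beta> - 1) / ln x) \<le> - 1) at_top"
    using \<gamma> \<beta> by real_asymp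
  then show ?thesis
    unfolding \<rho>1_def by eventually_elim (rule divide_right_mono, auto)
qed

lemma \<rho>1_lower: "eventually (\<lambda>x. - (x powr (- 13 / 7)) \<le> \<rho>1 x) at_top"
  unfolding \<rho>1_def using \<gamma> \<beta> by real_asymp

text \<open>With \<open>L = q^4\<close>, both \<open>L^3 * M\<close> and \<open>L^3 * r^2\<close>
  are \<open>1 / q\<close>, so \<open>curvature_small\<close> holds in the limit. The tolerance is
  \<open>L^4\<close> plus 2 for the rounding of four terms.\<close>

lemma eventually_convex_block:
  "eventually (\<lambda>q::nat. convex_block F F1 \<rho> \<rho>1 (real q ^ 7) (real q ^ 4) (real q ^ 16 + 2)
     (1 / (9 * real q ^ 14)) (real q powr - 13) (real q powr (- 13 / 2))) sequentially"
proof -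
  have "eventually (\<lambda>x. x ^ 10 \<le> F1 x \<and> 0 \<le> \<rho> x \<and> \<rho> x \<le> x powr (- 13 / 14) \<and>
      \<rho>1 x \<le> - 1 / x\<^sup>2 \<and> - (x powr (- 13 / 7)) \<le> \<rho>1 x \<and> 1 < x) at_top"
    using F1_lower \<rho>_upper \<rho>1_upper \<rho>1_lower eventually_gt_at_top[of "1 :: real"]
    by eventually_elim auto
  then obtain X where X: "\<And>x. X \<le> x \<Longrightarrow> x ^ 10 \<le> F1 x \<and> 0 \<le> \<rho> x \<and> \<rho> x \<le> x powr (- 13 / 14) \<and>
      \<rho>1 x \<le> - 1 / x\<^sup>2 \<and> - (x powr (- 13 / 7)) \<le> \<rho>1 x \<and> 1 < x"
    by (auto simp: eventually_at_top_linorder)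
  have "eventually (\<lambda>y::real. y ^ 4 * y powr (- 13 / 2) \<le> 1 / 2) at_top"
    "eventually (\<lambda>y::real. (y ^ 4) ^ 3 * (6 * y powr - 13 + 8 * (y powr (- 13 / 2))\<^sup>2) 
        + 2 * ((y ^ 16 + 2) / y ^ 70) < 1) at_top"
    "eventually (\<lambda>y::real. (y ^ 16 + 2) / y ^ 70 \<le> 1 / 4) at_top"
    "eventually (\<lambda>y::real. 4 * ((y ^ 16 + 2) / y ^ 70) < 1 / (9 * y ^ 14)) at_top"
    by real_asymp+
  then have "eventually (\<lambda>y::real. y ^ 4 * y powr (- 13 / 2) \<le> 1 / 2 \<and>
      (y ^ 4) ^ 3 * (6 * y powr - 13 + 8 * (y powr (- 13 / 2))\<^sup>2) + 2 * ((y ^ 16 + 2) / y ^ 70) < 1 \<and>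
      (y ^ 16 + 2) / y ^ 70 \<le> 1 / 4 \<and> 4 * ((y ^ 16 + 2) / y ^ 70) < 1 / (9 * y ^ 14) \<and>
      max 1 X \<le> y) at_top"
    using eventually_ge_at_top[of "max 1 X"] by eventually_elim auto
  from eventually_compose_filterlim[OF this filterlim_real_sequentially] show ?thesis
  proof eventually_elim
    case (elim q)
    define y where "y = real q"
    have y: "1 \<le> y" "X \<le> y" using elim by (auto simp: y_def)
    have y7: "y \<le> y ^ 7" "y ^ 4 \<le> y ^ 7"
      using y power_increasing[of 1 7 y] power_increasing[of 4 7 y] by auto
    have in_X: "X \<le> x" "y ^ 7 \<le> x" "x \<le> 3 * y ^ 7" if "x \<in> {y ^ 7..y ^ 7 + 2 * y ^ 4}" for x
      using that y7 y by auto
    \<comment> \<open>Converts decay in \<open>x\<close> into decay in \<open>q\<close>.\<close>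
    have decr: "x powr - a \<le> y powr - (7 * a)" if "y ^ 7 \<le> x" "0 < a" for x a
    proof -
      have "x powr - a \<le> (y ^ 7) powr - a" using that y by (intro powr_mono2') auto
      also have "\<dots> = (y powr 7) powr - a" using y by (simp add: powr_numeral)
      also have "\<dots> = y powr - (7 * a)" by (simp add: powr_powr)
      finally show ?thesis .
    qed
    have W: "(y ^ 16 + 2) / F1 (y ^ 7) \<le> (y ^ 16 + 2) / y ^ 70"
    proof -
      have "y ^ 70 \<le> F1 (y ^ 7)" using X[of "y ^ 7"] y y7 by (simp flip: power_mult)
      moreover have "0 < y ^ 70" using y by simp
      ultimately show ?thesis
        using y by (intro divide_left_mono mult_pos_pos) (auto intro: less_le_trans[of 0 "y ^ 70"])
    qed
    have "convex_block F F1 \<rho> \<rho>1 (y ^ 7) (y ^ 4) (y ^ 16 + 2) (1 / (9 * y ^ 14)) (y powr - 13) (y powr (- 13 / 2))"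
    proof
      fix x assume x: "x \<in> {y ^ 7..y ^ 7 + 2 * y ^ 4}"
      note X' = X[OF in_X(1)[OF x]]
      show "(F has_real_derivative F1 x) (at x)" "(F1 has_real_derivative F1 x * \<rho> x) (at x)"
        "(\<rho> has_real_derivative \<rho>1 x) (at x)"
        using X' F_deriv F1_deriv \<rho>_deriv by auto
      show "0 < F1 x" using X' by (smt (verit) zero_less_power)
      show "0 \<le> \<rho> x \<and> \<rho> x \<le> y powr (- 13 / 2)"
        using X' decr[OF in_X(2)[OF x], of "13 / 14"] by auto
      \<comment> \<open>The 9 comes from \<open>x \<le> 3 * y^7\<close> throughout the
        window.\<close>
      have "1 / (9 * y ^ 14) \<le> 1 / x\<^sup>2"
      proof -
        have "x\<^sup>2 \<le> (3 * y ^ 7)\<^sup>2" using in_X[OF x] X' by (intro power_mono) auto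
        then show ?thesis using X' y
          by (intro divide_left_mono mult_pos_pos) (auto simp: power_mult_distrib simp flip: power_mult)
      qed
      then show "- (y powr - 13) \<le> \<rho>1 x \<and> \<rho>1 x \<le> - (1 / (9 * y ^ 14))"
        using X' decr[OF in_X(2)[OF x], of "13 / 7"] by auto
    next
      show "0 < y ^ 4" "0 < 1 / (9 * y ^ 14)" "0 \<le> y ^ 16 + 2" "y ^ 4 * y powr (- 13 / 2) \<le> 1 / 2"
        using y elim by (auto simp: y_def)
      show "(y ^ 4) ^ 3 * (6 * y powr - 13 + 8 * (y powr (- 13 / 2))\<^sup>2) + 2 * (y ^ 16 + 2) / F1 (y ^ 7) < 1"
        "(y ^ 16 + 2) / F1 (y ^ 7) \<le> 1 / 4" "4 * (y ^ 16 + 2) / F1 (y ^ 7) < 1 / (9 * y ^ 14)"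
        using elim W unfolding y_def[symmetric] by (simp_all only: times_divide_eq_right[symmetric]) linarith+
    qed
    then show ?case unfolding y_def .
  qed
qed

section \<open>From \<open>F\<close> to the integer sequence and its discrepancy\<close>

definition a :: "nat \<Rightarrow> real" where
  "a n = real_of_int (a_seq \<gamma> \<beta> n)"

definition block :: "nat \<Rightarrow> nat set" where
  "block q = {q ^ 7 + 1..q ^ 7 + q ^ 4}"

lemma a_bounds: "a n \<le> F (real n)" "F (real n) < a n + 1"
  by (simp_all add: a_def a_seq_def F_def)

lemma card_block: "card (block q) = q ^ 4"
  by (simp add: block_def)

text \<open>The constant is \<open>1 / (16 * 15)\<close>: in \<open>large_values_measure\<close>,
  \<open>C = 15\<close> comes from the quasi-energy bound 14 plus 1 for the oscillating
  terms.\<close>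

lemma large_values_on_block:
  assumes "x < y"
  shows "eventually (\<lambda>q. 1 / 240 * (y - x) \<le>
    measure lebesgue ({\<alpha>. real (q ^ 4) / 4 \<le> (cmod (expsum a (block q) \<alpha>))\<^sup>2} \<inter> {x..y})) sequentially"
proof -
  define d where "d = y - x"
  have "0 < d" using assms by (simp add: d_def)
  \<comment> \<open>Used twice: the off-diagonal loss \<open>q^8 / q^16\<close> must stay below a
    quarter of the main term, and the term 1 in the fourth moment below
    \<open>q^8 * d\<close>.\<close>
  then have "eventually (\<lambda>q::nat. 4 \<le> real q ^ 8 * d) sequentially" by real_asymp
  then show ?thesis
    using eventually_convex_block eventually_ge_at_top[of "1 :: nat"]
  proof eventually_elim
    case (elim q)
    interpret convex_block F F1 \<rho> \<rho>1 "real q ^ 7" "real q ^ 4" "real q ^ 16 + 2"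
      "1 / (9 * real q ^ 14)" "real q powr - 13" "real q powr (- 13 / 2)"
      by (rule elim)
    have q: "1 \<le> real q" using elim by simp
    have A: "4 * (real q ^ 16 + 2) \<le> F1 (real q ^ 7)"
      using W_small(1) F1_N_pos by (simp add: field_simps)
    have gap: "real q ^ 16 \<le> \<bar>a i - a j\<bar>" if "i \<in> block q" "j \<in> block q" "i \<noteq> j" for i j
    proof -
      have "real q ^ 16 \<le> a j - a i" if ij: "i \<in> block q" "j \<in> block q" "i < j" for i j
      proof -
        have r: "real q ^ 7 \<le> real i" "real j \<le> real q ^ 7 + real q ^ 4"
          using ij by (simp_all add: block_def flip: of_nat_power of_nat_add)
        have "F1 (real q ^ 7) * 1 \<le> F1 (real q ^ 7) * (real j - real i)"
          using F1_N_pos ij by (intro mult_left_mono) auto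
        also have "\<dots> \<le> F j - F i"
        proof (rule F_increment)
          show "real i \<le> real j" using ij by simp
        qed (use r L_pos in linarith)+
        finally have "F1 (real q ^ 7) \<le> F j - F i" by simp
        then have "4 * (real q ^ 16 + 2) - 1 \<le> a j - a i"
          using A a_bounds(1)[of i] a_bounds(2)[of j] by linarith
        moreover have "real q ^ 16 \<le> 4 * (real q ^ 16 + 2) - 1" by simp
        ultimately show ?thesis by (rule order_trans[rotated])
      qed
      from this[of i j] this[of j i] that show ?thesis by (cases i j rule: linorder_cases) auto
    qed
    \<comment> \<open>Rounding errors lie in \<open>[0, 1)\<close> and enter twice with each sign,
      so they change the expression by at most 2.\<close>
    have "quasi_energy a (block q) (real q ^ 16) \<le> quasi_energy (\<lambda>n. F (real n)) (block q) (real q ^ 16 + 2)"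
      unfolding quasi_energy_def
    proof (intro card_mono)
      show "finite {(k, l, m, n) \<in> block q \<times> block q \<times> block q \<times> block q.
          \<bar>F (real k) + F (real l) - F (real m) - F (real n)\<bar> \<le> real q ^ 16 + 2}"
        by (rule finite_subset[of _ "block q \<times> block q \<times> block q \<times> block q"]) (auto simp: block_def)
      have "\<bar>F (real k) + F (real l) - F (real m) - F (real n)\<bar> \<le> real q ^ 16 + 2"
        if "\<bar>a k + a l - a m - a n\<bar> \<le> real q ^ 16" for k l m n
        using that a_bounds[of k] a_bounds[of l] a_bounds[of m] a_bounds[of n] by linarith
      then show "{(k, l, m, n) \<in> block q \<times> block q \<times> block q \<times> block q. \<bar>a k + a l - a m - a n\<bar> \<le> real q ^ 16} \<subseteq>
          {(k, l, m, n) \<in> block q \<times> block q \<times> block q \<times> block q.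
            \<bar>F (real k) + F (real l) - F (real m) - F (real n)\<bar> \<le> real q ^ 16 + 2}"
        by auto
    qed
    also have "\<dots> \<le> 14 * (q ^ 4)\<^sup>2"
      unfolding block_def by (rule quasi_energy_le) simp_all
    finally have "real (quasi_energy a (block q) (real q ^ 16)) \<le> real (14 * (q ^ 4)\<^sup>2)"
      by (rule of_nat_mono)
    then have energy: "real (quasi_energy a (block q) (real q ^ 16)) \<le> 14 * real q ^ 8"
      by (simp flip: power_mult)
    have "(y - x) / (16 * 15) \<le>
        measure lebesgue ({\<alpha>. real (card (block q)) / 4 \<le> (cmod (expsum a (block q) \<alpha>))\<^sup>2} \<inter> {x..y})"
    proof (rule large_values_measure)
      show "finite (block q)" "block q \<noteq> {}" using q by (auto simp: block_def)
      have "real q ^ 8 / real q ^ 16 = 1 / real q ^ 8"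
        using q by (simp add: field_simps flip: power_add)
      also have "\<dots> \<le> (real q ^ 8 * d / 4) / real q ^ 8"
        using elim(1) q by (intro divide_right_mono) auto
      also have "\<dots> = d / 4" using q by simp
      also have "\<dots> \<le> real q ^ 4 * d / 4"
        using q \<open>0 < d\<close> mult_right_mono[of 1 "real q ^ 4" d] by simp
      finally have "3 / 4 * real (card (block q)) * (y - x) \<le>
          real (card (block q)) * (y - x) - (real (card (block q)))\<^sup>2 / real q ^ 16"
        by (simp add: card_block d_def mult.commute flip: power_mult)
      also have "\<dots> \<le> integral {x..y} (\<lambda>\<alpha>. (cmod (expsum a (block q) \<alpha>))\<^sup>2)"
        using q assms gap by (intro second_moment_ge) (auto simp: block_def)
      finally show "3 / 4 * real (card (block q)) * (y - x) \<le> integral {x..y} (\<lambda>\<alpha>. (cmod (expsum a (block q) \<alpha>))\<^sup>2)" .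
      have "integral {x..y} (\<lambda>\<alpha>. (cmod (expsum a (block q) \<alpha>)) ^ 4) \<le>
          real (quasi_energy a (block q) (real q ^ 16)) * (y - x) + (real (card (block q))) ^ 4 / real q ^ 16"
        using q assms by (intro fourth_moment_le) (auto simp: block_def)
      also have "\<dots> \<le> 14 * real q ^ 8 * (y - x) + 1"
        using energy assms q by (intro add_mono mult_right_mono) (simp_all add: card_block flip: power_mult)
      also have "\<dots> \<le> 15 * (real (card (block q)))\<^sup>2 * (y - x)"
        using elim(1) by (simp add: card_block d_def mult.commute flip: power_mult)
      finally show "integral {x..y} (\<lambda>\<alpha>. (cmod (expsum a (block q) \<alpha>)) ^ 4) \<le>
          15 * (real (card (block q)))\<^sup>2 * (y - x)" .
    qed (use assms in auto)
    then show ?case by (simp add: card_block)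
  qed
qed

lemma AE_frequently_large:
  "AE \<alpha> in lebesgue. \<exists>\<^sub>F q in sequentially. real (q ^ 4) / 4 \<le> (cmod (expsum a (block q) \<alpha>))\<^sup>2"
proof -
  have "closed {\<alpha>. real (q ^ 4) / 4 \<le> (cmod (expsum a (block q) \<alpha>))\<^sup>2}" for q
    by (intro closed_Collect_le continuous_intros continuous_on_expsum)
  then have "AE \<alpha> in lebesgue. \<exists>\<^sub>F q in sequentially.
      \<alpha> \<in> {\<alpha>. real (q ^ 4) / 4 \<le> (cmod (expsum a (block q) \<alpha>))\<^sup>2}"
    by (intro AE_frequently_in_if_uniformly_dense[where c = "1 / 240"] large_values_on_block) auto
  then show ?thesis by simp
qed

text \<open>The block is the difference of two initial segments, and Koksma's inequality applies to
  each; fractional parts are harmless as \<open>cis\<close> has period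
  \<open>2 * pi\<close>.\<close>

lemma norm_expsum_block_le:
  fixes \<alpha> :: real
  defines "D \<equiv> star_discrepancy (\<lambda>n. frac (a n * \<alpha>))"
  shows "cmod (expsum a (block q) \<alpha>) \<le>
    2 * pi * (real (q ^ 7 + q ^ 4) * D (q ^ 7 + q ^ 4) + real (q ^ 7) * D (q ^ 7))"
proof -
  define S where "S N = (\<Sum>n = 1..N. cis (2 * pi * frac (a n * \<alpha>)))" for N
  have cis_frac: "cis (2 * pi * frac z) = cis (2 * pi * z)" for z
  proof -
    have "cis (2 * pi * frac z) = cis (2 * pi * z) * cis (- (2 * pi * real_of_int \<lfloor>z\<rfloor>))"
      by (simp add: cis_mult frac_def algebra_simps)
    also have "cis (- (2 * pi * real_of_int \<lfloor>z\<rfloor>)) = 1"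
      using cis_multiple_2pi[of "- real_of_int \<lfloor>z\<rfloor>"] by simp
    finally show ?thesis by simp
  qed
  have "{1..q ^ 7 + q ^ 4} = {1..q ^ 7} \<union> block q" "{1..q ^ 7} \<inter> block q = {}"
    by (auto simp: block_def)
  then have "S (q ^ 7 + q ^ 4) = S (q ^ 7) + expsum a (block q) \<alpha>"
    unfolding S_def expsum_def cis_frac
    by (simp add: sum.union_disjoint block_def mult.assoc)
  then have "cmod (expsum a (block q) \<alpha>) \<le> cmod (S (q ^ 7 + q ^ 4)) + cmod (S (q ^ 7))"
    by (metis add_diff_cancel_left' norm_triangle_ineq4)
  also have "cmod (S N) \<le> 2 * pi * (real N * D N)" for N
    unfolding S_def D_def by (rule norm_sum_cis_le_star_discrepancy) (simp add: frac_lt_1)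
  from add_mono[OF this this] have "cmod (S (q ^ 7 + q ^ 4)) + cmod (S (q ^ 7)) \<le>
    2 * pi * (real (q ^ 7 + q ^ 4) * D (q ^ 7 + q ^ 4)) + 2 * pi * (real (q ^ 7) * D (q ^ 7))" .
  finally show ?thesis by (simp add: algebra_simps)
qed

text \<open>At one of the two ends of the block \<open>N * D*_N\<close> is at least
  \<open>q^2 / (8 * pi)\<close>, and \<open>N \<le> 2 * q^7\<close> bounds
  \<open>N powr (2 / 7)\<close> by \<open>2 * q^2\<close>; hence the constant
  \<open>1 / (16 * pi)\<close>.\<close>

lemma Omega_io_if_frequently_large:
  assumes "\<exists>\<^sub>F q in sequentially. real (q ^ 4) / 4 \<le> (cmod (expsum a (block q) \<alpha>))\<^sup>2" and "0 < \<epsilon>"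
  shows "(\<lambda>N. real N * star_discrepancy (\<lambda>n. frac (a n * \<alpha>)) N) \<in> Omega_io (\<lambda>N. real N powr (7 / 26 - \<epsilon>))"
proof -
  define f where "f N = real N * star_discrepancy (\<lambda>n. frac (a n * \<alpha>)) N" for N
  have "\<exists>N\<ge>m. 1 / (16 * pi) * real N powr (7 / 26 - \<epsilon>) \<le> f N" for m
  proof -
    obtain q where q: "max 1 m \<le> q" "real (q ^ 4) / 4 \<le> (cmod (expsum a (block q) \<alpha>))\<^sup>2"
      using assms(1) unfolding frequently_sequentially by blast
    have "(real q ^ 2 / 2)\<^sup>2 \<le> (cmod (expsum a (block q) \<alpha>))\<^sup>2"
      using q by (simp add: power_divide flip: power_mult)
    then have "real q ^ 2 / 2 \<le> cmod (expsum a (block q) \<alpha>)"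
      by (rule power2_le_imp_le) simp
    also have "\<dots> \<le> 2 * pi * (f (q ^ 7 + q ^ 4) + f (q ^ 7))"
      unfolding f_def by (rule norm_expsum_block_le)
    finally have "real q ^ 2 / (4 * pi) \<le> f (q ^ 7 + q ^ 4) + f (q ^ 7)"
      by (simp add: field_simps)
    then consider "real q ^ 2 / (8 * pi) \<le> f (q ^ 7 + q ^ 4)" | "real q ^ 2 / (8 * pi) \<le> f (q ^ 7)"
      using field_sum_of_halves[of "real q ^ 2 / (4 * pi)"] by fastforce
    then obtain N where N: "q ^ 7 \<le> N" "N \<le> q ^ 7 + q ^ 4" "real q ^ 2 / (8 * pi) \<le> f N"
      by (metis le_add1 order_refl)
    have "1 \<le> q" using q by simp
    then have qq: "q \<le> q ^ 7" "q ^ 4 \<le> q ^ 7"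
      using power_increasing[of 1 7 q] power_increasing[of 4 7 q] by auto
    \<comment> \<open>Here \<open>7 / 26 < 2 / 7\<close> and \<open>N \<ge> 1\<close>.\<close>
    have "real N powr (7 / 26 - \<epsilon>) \<le> real N powr (2 / 7)"
      using N qq \<open>1 \<le> q\<close> assms(2) by (intro powr_mono) auto
    also have "\<dots> \<le> (2 * real q ^ 7) powr (2 / 7)"
    proof (rule powr_mono2)
      have "real N \<le> real (2 * q ^ 7)" using N qq by (intro of_nat_mono) linarith
      then show "real N \<le> 2 * real q ^ 7" by simp
    qed auto
    also have "\<dots> = 2 powr (2 / 7) * real q ^ 2"
      using powr_powr[of "real q" 7 "2 / 7"] \<open>1 \<le> q\<close> by (simp add: powr_mult powr_numeral)
    also have "\<dots> \<le> 2 powr 1 * real q ^ 2"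
      by (intro mult_right_mono powr_mono) auto
    finally have "1 / (16 * pi) * real N powr (7 / 26 - \<epsilon>) \<le> 1 / (16 * pi) * (2 * real q ^ 2)"
      by (intro mult_left_mono) auto
    also have "\<dots> \<le> f N" using N(3) by simp
    finally show ?thesis using N(1) qq q by (intro exI[of _ N]) auto
  qed
  then have "infinite {N. 1 / (16 * pi) * real N powr (7 / 26 - \<epsilon>) \<le> f N}"
    by (auto simp: infinite_nat_iff_unbounded_le)
  then show ?thesis
    unfolding Omega_io_def f_def using pi_gt_zero by (intro CollectI exI[of _ "1 / (16 * pi)"]) auto
qed

end

text \<open>The almost sure event in \<open>AE_frequently_large\<close> does not involve
  \<open>\<epsilon>\<close>, so one null set serves all \<open>\<epsilon>\<close> at once.\<close>

theorem corollary3: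
  fixes \<gamma> \<beta> :: real
  assumes "\<gamma> > 0" and "1 < \<beta>" and "\<beta> \<le> 2"
  shows "AE \<alpha> in lebesgue. \<forall>\<epsilon>>0.
    (\<lambda>N. real N * star_discrepancy (\<lambda>n. frac (real_of_int (a_seq \<gamma> \<beta> n) * \<alpha>)) N)
      \<in> Omega_io (\<lambda>N. real N powr (7 / 26 - \<epsilon>))"
proof -
  interpret log_power_growth \<gamma> \<beta>
    using assms by unfold_locales
  show ?thesis
    using AE_frequently_large
    by eventually_elim (use Omega_io_if_frequently_large in \<open>simp add: a_def\<close>)
qed

end
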